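(* Let $\mathcal B$ be a $\mathcal T$-shadowed bicategory equipped with $G$-twisting data, and let $g\in G$. For 1-cells $M\colon R\to S$ and $N\colon S\to R$ in $\mathcal B^{G\text{-tw}}$, the twofold twisted cyclicity operator $$\Psi={}^g\theta_{N,M}\circ{}^g\theta_{M,N}\colon{}^g\langle\!\langle M\odot N\rangle\!\rangle_R\xrightarrow{\cong}{}^g\langle\!\langle M\odot N\rangle\!\rangle_R$$ coincides with $\mathbf C_{g,g}(M\odot N)$. In particular, if $g$ has finite order $n$, then the $2n$-fold composite of twisted cyclicity is the identity: $$\bigl({}^g\theta_{N,M}\circ{}^g\theta_{M,N}\bigr)^n=\mathrm{id}_{{}^g\langle\!\langle M\odot N\rangle\!\rangle_R}.$$
   Context: **Bicategories.** For 1-cells $M\colon A\to B$, $N\colon B\to C$ the horizontal composite is written $M\odot N\colon A\to C$ (first $M$, then $N$); $U_A$ is the unit 1-cell; associators and unitors $\mathfrak a,\mathfrak l,\mathfrak r$ are suppressed where harmless. $\mathrm{Pic}_{\mathcal B}(A)$ is the monoidal groupoid (under $\odot$) of invertible 1-cells $A\to A$ and invertible 2-cells. **$G$-twisting data** ($G$ a group): for each 0-cell $A$ a strong monoidal functor $\Theta_A\colon G\to\mathrm{Pic}_{\mathcal B}(A)$ with structure 2-cells $\mu^A_{g,h}\colon\Theta_A(g)\odot\Theta_A(h)\Rightarrow\Theta_A(gh)$, $\eta^A\colon U_A\Rightarrow\Theta_A(e)$. For $M\colon A\to B$: ${}^gM=\Theta_A(g^{-1})\odot M$, $M^g=M\odot\Theta_B(g)$;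 ${}^gf=\mathrm{id}\odot f$ for a 2-cell $f$. **Bicategory of $G$-twists $\mathcal B^{G\text{-tw}}$.** Same 0-cells. A 1-cell $A\to B$ is $(M,\tau)$ with $M\colon A\to B$ in $\mathcal B$ and invertible 2-cells $\tau_g\colon\Theta_A(g)\odot M\Rightarrow M\odot\Theta_B(g)$, $g\in G$, such that $\tau_e$ is the canonical isomorphism given by $\eta^A,\eta^B$ and unitors, and $\tau_{gh}=(\mathrm{id}_M\odot\mu^B_{g,h})(\tau_g\odot\mathrm{id})(\mathrm{id}\odot\tau_h)((\mu^A_{g,h})^{-1}\odot\mathrm{id}_M)$. A 2-cell $(M,\tau)\Rightarrow(N,\sigma)$ is a 2-cell $f\colon M\Rightarrow N$ with $\sigma_g(\mathrm{id}\odot f)=(f\odot\mathrm{id})\tau_g$ for all $g$. Composite: $(M\odot N,\tau\star\sigma)$, $(\tau\star\sigma)_g=(\mathrm{id}_M\odot\sigma_g)(\tau_g\odot\mathrm{id}_N)$. Unit: $U_A$ with $\mathfrak l^{-1}\mathfrak r$. Transport map: $g_M=(\tau_{g^{-1}})^{-1}\colon M^{g^{-1}}\Rightarrow{}^gM$. **Shadows.** A $\mathcal T$-shadow on $\mathcal B$ is a family of functors $\langle\!\langle-\rangle\!\rangle_R\colon\mathcal B(R,R)\to\mathcal T$ with natural isomorphisms $\theta_{M,N}\colon\langle\!\langle M\odot N\rangle\!\rangle_R\cong\langle\!\langle N\odot M\rangle\!\rangle_S$ ($M\colon R\to S$, $N\colon S\to R$) such that, up to associators, $\theta_{M\odot N,P}=\theta_{N,P\odot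 M}\circ\theta_{M,N\odot P}$, and $\langle\!\langle\mathfrak l\rangle\!\rangle\circ\theta_{M,U_R}=\langle\!\langle\mathfrak r\rangle\!\rangle$, $\langle\!\langle\mathfrak r\rangle\!\rangle\circ\theta_{U_R,M}=\langle\!\langle\mathfrak l\rangle\!\rangle$. **Induced $g$-twisted shadow.** ${}^g\langle\!\langle(M,\tau)\rangle\!\rangle_R=\langle\!\langle{}^gM\rangle\!\rangle_R$. The twisted cyclicity ${}^g\theta_{M,N}\colon{}^g\langle\!\langle M\odot N\rangle\!\rangle_R\to{}^g\langle\!\langle N\odot M\rangle\!\rangle_S$ is the composite $\langle\!\langle\Theta_R(g^{-1})\odot M\odot N\rangle\!\rangle_R\xrightarrow{\theta}\langle\!\langle N\odot\Theta_R(g^{-1})\odot M\rangle\!\rangle_S\xrightarrow{\langle\!\langle g_N\odot\mathrm{id}_M\rangle\!\rangle}\langle\!\langle\Theta_S(g^{-1})\odot N\odot M\rangle\!\rangle_S$. **Conjugation transport.** For $M\in\mathcal B^{G\text{-tw}}(R,R)$ and $g,h\in G$, $\mathbf C_{h,g}(M)\colon{}^g\langle\!\langle M\rangle\!\rangle_R\to{}^{hgh^{-1}}\langle\!\langle M\rangle\!\rangle_R$ is the composite $$\langle\!\langle\Theta_R(g^{-1})\odot M\rangle\!\rangle\cong\langle\!\langle\Theta_R(g^{-1})\odot M\odot\Theta_R(h^{-1})\odot\Theta_R(h)\rangle\!\rangle\xrightarrow{\theta}\langle\!\langle\Theta_R(h)\odot\Theta_R(g^{-1})\odot M\odot\Theta_R(h^{-1})\rangle\!\rangle$$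 $$\xrightarrow{\mathrm{id}\odot\mathrm{id}\odot h_M}\langle\!\langle\Theta_R(h)\odot\Theta_R(g^{-1})\odot\Theta_R(h^{-1})\odot M\rangle\!\rangle\xrightarrow{\mu\odot\mathrm{id}_M}\langle\!\langle\Theta_R(hg^{-1}h^{-1})\odot M\rangle\!\rangle,$$ where the first isomorphism is the canonical one $U_R\cong\Theta_R(e)\cong\Theta_R(h^{-1})\odot\Theta_R(h)$, and $\mu$ is the iterated multiplication of $\Theta_R$. *)

theory Defs
  imports "HOL-Algebra.Multiplicative_Group"
begin

no_notation smult (infixl "\<odot>\<index>" 70)

section \<open>Categories\<close>

record ('x, 't) cat =
  Ob  :: "'x set"
  Ar  :: "'t set"
  Dom :: "'t \<Rightarrow> 'x"
  Cod :: "'t \<Rightarrow> 'x"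
  Idn :: "'x \<Rightarrow> 't"
  Cmp :: "'t \<Rightarrow> 't \<Rightarrow> 't"  (infixr "\<cdot>\<index>" 60)  \<comment> \<open>\<open>g \<cdot> f\<close> is \<open>g\<close> after \<open>f\<close>\<close>

definition arrs :: "('x, 't, 'z) cat_scheme \<Rightarrow> 'x \<Rightarrow> 'x \<Rightarrow> 't set" where
  "arrs C x y = {f \<in> Ar C. Dom C f = x \<and> Cod C f = y}"

definition isos :: "('x, 't, 'z) cat_scheme \<Rightarrow> 'x \<Rightarrow> 'x \<Rightarrow> 't set" where
  "isos C x y = {f \<in> arrs C x y. \<exists>k \<in> arrs C y x.
     k \<cdot>\<^bsub>C\<^esub> f = Idn C x \<and> f \<cdot>\<^bsub>C\<^esub> k = Idn C y}"

definition cinv :: "('x, 't, 'z) cat_scheme \<Rightarrow> 't \<Rightarrow> 't" where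
  "cinv C f = (THE k. k \<in> arrs C (Cod C f) (Dom C f)
     \<and> k \<cdot>\<^bsub>C\<^esub> f = Idn C (Dom C f) \<and> f \<cdot>\<^bsub>C\<^esub> k = Idn C (Cod C f))"

primrec cpow :: "('x, 't, 'z) cat_scheme \<Rightarrow> 't \<Rightarrow> nat \<Rightarrow> 't" where
  "cpow C f 0 = Idn C (Dom C f)"
| "cpow C f (Suc n) = f \<cdot>\<^bsub>C\<^esub> cpow C f n"

locale category =
  fixes C :: "('x, 't, 'z) cat_scheme" (structure)
  assumes dom_in: "f \<in> Ar C \<Longrightarrow> Dom C f \<in> Ob C"
    and cod_in: "f \<in> Ar C \<Longrightarrow> Cod C f \<in> Ob C"
    and idn_in: "x \<in> Ob C \<Longrightarrow> Idn C x \<in> arrs C x x"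
    and cmp_in: "\<lbrakk>f \<in> arrs C x y; g \<in> arrs C y z\<rbrakk> \<Longrightarrow> g \<cdot> f \<in> arrs C x z"
    and idn_cmp: "f \<in> arrs C x y \<Longrightarrow> Idn C y \<cdot> f = f"
    and cmp_idn: "f \<in> arrs C x y \<Longrightarrow> f \<cdot> Idn C x = f"
    and cmp_assoc: "\<lbrakk>f \<in> arrs C w x; g \<in> arrs C x y; h \<in> arrs C y z\<rbrakk>
                    \<Longrightarrow> (h \<cdot> g) \<cdot> f = h \<cdot> (g \<cdot> f)"

definition is_functor ::
  "('x, 't, 'y) cat_scheme \<Rightarrow> ('u, 'v, 'z) cat_scheme \<Rightarrow> ('x \<Rightarrow> 'u) \<Rightarrow> ('t \<Rightarrow> 'v) \<Rightarrow> bool" where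
  "is_functor C D Fo Fa \<longleftrightarrow>
     (\<forall>x \<in> Ob C. Fo x \<in> Ob D \<and> Fa (Idn C x) = Idn D (Fo x)) \<and>
     (\<forall>x y. \<forall>f \<in> arrs C x y. Fa f \<in> arrs D (Fo x) (Fo y)) \<and>
     (\<forall>x y z. \<forall>f \<in> arrs C x y. \<forall>g \<in> arrs C y z. Fa (g \<cdot>\<^bsub>C\<^esub> f) = Fa g \<cdot>\<^bsub>D\<^esub> Fa f)"


section \<open>Bicategories\<close>

text \<open>
  All hom-categories of a bicategory are collected into one category (their disjoint union):
  its objects are the 1-cells, its arrows the 2-cells, its composition the vertical one.
  Horizontal composition is written in diagrammatic order: for \<open>M : A \<rightarrow> B\<close> and
  \<open>N : B \<rightarrow> C\<close> the composite is \<open>M \<odot> N : A \<rightarrow> C\<close>; on 2-cells it is written \<open>f \<star> g\<close>.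
  The associator is \<open>assoc M N P : (M \<odot> N) \<odot> P \<Rightarrow> M \<odot> (N \<odot> P)\<close>, and the unitors are
  \<open>lunit M : U \<odot> M \<Rightarrow> M\<close> and \<open>runit M : M \<odot> U \<Rightarrow> M\<close>.
\<close>

record ('o, 'a, 'c) bicat = "('a, 'c) cat" +
  Cells0 :: "'o set"
  src    :: "'a \<Rightarrow> 'o"
  trg    :: "'a \<Rightarrow> 'o"
  unit1  :: "'o \<Rightarrow> 'a"  ("U\<index>")
  comp1  :: "'a \<Rightarrow> 'a \<Rightarrow> 'a"  (infixl "\<odot>\<index>" 70)
  comp2  :: "'c \<Rightarrow> 'c \<Rightarrow> 'c"  (infixl "\<star>\<index>" 70)
  assoc  :: "'a \<Rightarrow> 'a \<Rightarrow> 'a \<Rightarrow> 'c"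
  lunit  :: "'a \<Rightarrow> 'c"
  runit  :: "'a \<Rightarrow> 'c"

definition cell1 :: "('o, 'a, 'c, 'z) bicat_scheme \<Rightarrow> 'o \<Rightarrow> 'o \<Rightarrow> 'a set" where
  "cell1 B A A' = {M \<in> Ob B. src B M = A \<and> trg B M = A'}"

definition hom_cat :: "('o, 'a, 'c, 'z) bicat_scheme \<Rightarrow> 'o \<Rightarrow> 'o \<Rightarrow> ('a, 'c) cat" where
  "hom_cat B A A' =
     \<lparr>Ob = cell1 B A A',
      Ar = {f \<in> Ar B. Dom B f \<in> cell1 B A A' \<and> Cod B f \<in> cell1 B A A'},
      Dom = Dom B, Cod = Cod B, Idn = Idn B, Cmp = Cmp B\<rparr>"

locale bicategory = category B
  for B :: "('o, 'a, 'c, 'z) bicat_scheme" (structure) +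
  assumes src_in: "M \<in> Ob B \<Longrightarrow> src B M \<in> Cells0 B"
    and trg_in: "M \<in> Ob B \<Longrightarrow> trg B M \<in> Cells0 B"
    and src_cod: "f \<in> Ar B \<Longrightarrow> src B (Cod B f) = src B (Dom B f)"
    and trg_cod: "f \<in> Ar B \<Longrightarrow> trg B (Cod B f) = trg B (Dom B f)"
    and unit1_in: "A \<in> Cells0 B \<Longrightarrow> U A \<in> cell1 B A A"
    and comp1_in: "\<lbrakk>M \<in> cell1 B A A'; N \<in> cell1 B A' A''\<rbrakk> \<Longrightarrow> M \<odot> N \<in> cell1 B A A''"
    and comp2_in: "\<lbrakk>f \<in> arrs B M M'; g \<in> arrs B N N'; trg B M = src B N\<rbrakk>
                   \<Longrightarrow> f \<star> g \<in> arrs B (M \<odot> N) (M' \<odot> N')"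
    and comp2_idn: "\<lbrakk>M \<in> cell1 B A A'; N \<in> cell1 B A' A''\<rbrakk>
                    \<Longrightarrow> Idn B M \<star> Idn B N = Idn B (M \<odot> N)"
    and interchange:
      "\<lbrakk>f \<in> arrs B M M'; f' \<in> arrs B M' M''; g \<in> arrs B N N'; g' \<in> arrs B N' N'';
        trg B M = src B N\<rbrakk>
       \<Longrightarrow> (f' \<cdot> f) \<star> (g' \<cdot> g) = (f' \<star> g') \<cdot> (f \<star> g)"
    and assoc_iso:
      "\<lbrakk>M \<in> cell1 B A1 A2; N \<in> cell1 B A2 A3; P \<in> cell1 B A3 A4\<rbrakk>
       \<Longrightarrow> assoc B M N P \<in> isos B ((M \<odot> N) \<odot> P) (M \<odot> (N \<odot> P))"
    and assoc_natural:
      "\<lbrakk>f \<in> arrs B M M'; g \<in> arrs B N N'; h \<in> arrs B P P';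
        trg B M = src B N; trg B N = src B P\<rbrakk>
       \<Longrightarrow> assoc B M' N' P' \<cdot> ((f \<star> g) \<star> h) = (f \<star> (g \<star> h)) \<cdot> assoc B M N P"
    and lunit_iso: "M \<in> cell1 B A A' \<Longrightarrow> lunit B M \<in> isos B (U A \<odot> M) M"
    and lunit_natural:
      "\<lbrakk>f \<in> arrs B M M'; M \<in> cell1 B A A'\<rbrakk>
       \<Longrightarrow> lunit B M' \<cdot> (Idn B (U A) \<star> f) = f \<cdot> lunit B M"
    and runit_iso: "M \<in> cell1 B A A' \<Longrightarrow> runit B M \<in> isos B (M \<odot> U A') M"
    and runit_natural:
      "\<lbrakk>f \<in> arrs B M M'; M \<in> cell1 B A A'\<rbrakk>
       \<Longrightarrow> runit B M' \<cdot> (f \<star> Idn B (U A')) = f \<cdot> runit B M"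
    and pentagon:
      "\<lbrakk>M \<in> cell1 B A1 A2; N \<in> cell1 B A2 A3; P \<in> cell1 B A3 A4; Q \<in> cell1 B A4 A5\<rbrakk>
       \<Longrightarrow> (Idn B M \<star> assoc B N P Q) \<cdot> assoc B M (N \<odot> P) Q \<cdot> (assoc B M N P \<star> Idn B Q)
         = assoc B M N (P \<odot> Q) \<cdot> assoc B (M \<odot> N) P Q"
    and triangle:
      "\<lbrakk>M \<in> cell1 B A A'; N \<in> cell1 B A' A''\<rbrakk>
       \<Longrightarrow> (Idn B M \<star> lunit B N) \<cdot> assoc B M (U A') N = runit B M \<star> Idn B N"

text \<open>Objects of the monoidal groupoid \<open>Pic\<^sub>B(A)\<close>; its arrows are the invertible 2-cells,
  that is, \<open>isos B\<close> between such objects.\<close>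

definition Pic :: "('o, 'a, 'c, 'z) bicat_scheme \<Rightarrow> 'o \<Rightarrow> 'a set" where
  "Pic B A = {M \<in> cell1 B A A. \<exists>N \<in> cell1 B A A.
     isos B (M \<odot>\<^bsub>B\<^esub> N) (U\<^bsub>B\<^esub> A) \<noteq> {} \<and> isos B (N \<odot>\<^bsub>B\<^esub> M) (U\<^bsub>B\<^esub> A) \<noteq> {}}"


section \<open>Shadows\<close>

text \<open>The family of functors on the categories \<open>B(R, R)\<close> is given by one map on 1-cells and
  one on 2-cells; the index \<open>R\<close> is the source of the 1-cell. Both maps are constrained on
  endo-1-cells only.\<close>

record ('a, 'c, 'x, 't) shadow_data =
  shO   :: "'a \<Rightarrow> 'x"
  shA   :: "'c \<Rightarrow> 't"
  theta :: "'a \<Rightarrow> 'a \<Rightarrow> 't"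

locale shadowed_bicategory = bicategory B + T: category T
  for B :: "('o, 'a, 'c, 'z) bicat_scheme" (structure)
    and T :: "('x, 't, 'y) cat_scheme"
    and S :: "('a, 'c, 'x, 't) shadow_data" +
  assumes shadow_functor: "R \<in> Cells0 B \<Longrightarrow> is_functor (hom_cat B R R) T (shO S) (shA S)"
    and theta_iso:
      "\<lbrakk>M \<in> cell1 B R Q; N \<in> cell1 B Q R\<rbrakk>
       \<Longrightarrow> theta S M N \<in> isos T (shO S (M \<odot> N)) (shO S (N \<odot> M))"
    and theta_natural:
      "\<lbrakk>M \<in> cell1 B R Q; N \<in> cell1 B Q R; f \<in> arrs B M M'; h \<in> arrs B N N'\<rbrakk>
       \<Longrightarrow> theta S M' N' \<cdot>\<^bsub>T\<^esub> shA S (f \<star> h) = shA S (h \<star> f) \<cdot>\<^bsub>T\<^esub> theta S M N"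
    and theta_hexagon:
      "\<lbrakk>M \<in> cell1 B R Q; N \<in> cell1 B Q K; P \<in> cell1 B K R\<rbrakk>
       \<Longrightarrow> theta S (M \<odot> N) P
         = shA S (assoc B P M N)
           \<cdot>\<^bsub>T\<^esub> theta S N (P \<odot> M)
           \<cdot>\<^bsub>T\<^esub> shA S (assoc B N P M)
           \<cdot>\<^bsub>T\<^esub> theta S M (N \<odot> P)
           \<cdot>\<^bsub>T\<^esub> shA S (assoc B M N P)"
    and theta_runit: "M \<in> cell1 B R R \<Longrightarrow>
        shA S (lunit B M) \<cdot>\<^bsub>T\<^esub> theta S M (U R) = shA S (runit B M)"
    and theta_lunit: "M \<in> cell1 B R R \<Longrightarrow>
        shA S (runit B M) \<cdot>\<^bsub>T\<^esub> theta S (U R) M = shA S (lunit B M)"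


section \<open>Twisting data\<close>

record ('o, 'g, 'a, 'c) twisting =
  Th  :: "'o \<Rightarrow> 'g \<Rightarrow> 'a"
  Mu  :: "'o \<Rightarrow> 'g \<Rightarrow> 'g \<Rightarrow> 'c"
  Eta :: "'o \<Rightarrow> 'c"

text \<open>The group \<open>G\<close> is regarded as a discrete monoidal category, so a strong monoidal functor
  \<open>G \<rightarrow> Pic\<^sub>B(A)\<close> consists of its values on objects and the invertible 2-cells \<open>\<mu>\<close> and \<open>\<eta>\<close>,
  subject to the associativity and unit laws.\<close>

locale twisting_data = bicategory B + G: group G
  for B :: "('o, 'a, 'c, 'z) bicat_scheme" (structure)
    and G :: "('g, 'y) monoid_scheme"
    and W :: "('o, 'g, 'a, 'c) twisting" +
  assumes Th_Pic: "\<lbrakk>A \<in> Cells0 B; g \<in> carrier G\<rbrakk> \<Longrightarrow> Th W A g \<in> Pic B A"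
    and Mu_iso:
      "\<lbrakk>A \<in> Cells0 B; g \<in> carrier G; h \<in> carrier G\<rbrakk>
       \<Longrightarrow> Mu W A g h \<in> isos B (Th W A g \<odot> Th W A h) (Th W A (g \<otimes>\<^bsub>G\<^esub> h))"
    and Eta_iso: "A \<in> Cells0 B \<Longrightarrow> Eta W A \<in> isos B (U A) (Th W A \<one>\<^bsub>G\<^esub>)"
    and Mu_assoc:
      "\<lbrakk>A \<in> Cells0 B; g \<in> carrier G; h \<in> carrier G; k \<in> carrier G\<rbrakk>
       \<Longrightarrow> Mu W A (g \<otimes>\<^bsub>G\<^esub> h) k \<cdot> (Mu W A g h \<star> Idn B (Th W A k))
         = Mu W A g (h \<otimes>\<^bsub>G\<^esub> k) \<cdot> (Idn B (Th W A g) \<star> Mu W A h k)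
           \<cdot> assoc B (Th W A g) (Th W A h) (Th W A k)"
    and Mu_lunit:
      "\<lbrakk>A \<in> Cells0 B; g \<in> carrier G\<rbrakk>
       \<Longrightarrow> Mu W A \<one>\<^bsub>G\<^esub> g \<cdot> (Eta W A \<star> Idn B (Th W A g)) = lunit B (Th W A g)"
    and Mu_runit:
      "\<lbrakk>A \<in> Cells0 B; g \<in> carrier G\<rbrakk>
       \<Longrightarrow> Mu W A g \<one>\<^bsub>G\<^esub> \<cdot> (Idn B (Th W A g) \<star> Eta W A) = runit B (Th W A g)"


section \<open>The bicategory of twists\<close>

context
  fixes B :: "('o, 'a, 'c, 'z) bicat_scheme" (structure)
    and G :: "('g, 'y) monoid_scheme"
    and W :: "('o, 'g, 'a, 'c) twisting"
begin

definition tw_cells1 :: "('a \<times> ('g \<Rightarrow> 'c)) set" where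
  "tw_cells1 = {(M, \<tau>).
     let \<Theta> = Th W (src B M); \<Theta>' = Th W (trg B M) in
     M \<in> Ob B \<and>
     \<tau> \<in> (\<Pi>\<^sub>E g \<in> carrier G. isos B (\<Theta> g \<odot> M) (M \<odot> \<Theta>' g)) \<and>
     \<tau> \<one>\<^bsub>G\<^esub> = (Idn B M \<star> Eta W (trg B M)) \<cdot> cinv B (runit B M)
             \<cdot> lunit B M \<cdot> (cinv B (Eta W (src B M)) \<star> Idn B M) \<and>
     (\<forall>g \<in> carrier G. \<forall>h \<in> carrier G.
        \<tau> (g \<otimes>\<^bsub>G\<^esub> h) =
          (Idn B M \<star> Mu W (trg B M) g h)
          \<cdot> assoc B M (\<Theta>' g) (\<Theta>' h)
          \<cdot> (\<tau> g \<star> Idn B (\<Theta>' h))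
          \<cdot> cinv B (assoc B (\<Theta> g) M (\<Theta>' h))
          \<cdot> (Idn B (\<Theta> g) \<star> \<tau> h)
          \<cdot> assoc B (\<Theta> g) (\<Theta> h) M
          \<cdot> (cinv B (Mu W (src B M) g h) \<star> Idn B M))}"

text \<open>A 2-cell of twists carries its source and target, since these are not determined by the
  underlying 2-cell of \<open>B\<close>.\<close>

definition tw_cells2 :: "(('a \<times> ('g \<Rightarrow> 'c)) \<times> 'c \<times> ('a \<times> ('g \<Rightarrow> 'c))) set" where
  "tw_cells2 = {(X, f, Y). X \<in> tw_cells1 \<and> Y \<in> tw_cells1 \<and> f \<in> arrs B (fst X) (fst Y) \<and>
     (\<forall>g \<in> carrier G.
        snd Y g \<cdot> (Idn B (Th W (src B (fst X)) g) \<star> f)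
        = (f \<star> Idn B (Th W (trg B (fst X)) g)) \<cdot> snd X g)}"

definition tw_unit :: "'o \<Rightarrow> 'a \<times> ('g \<Rightarrow> 'c)" where
  "tw_unit A = (U A, \<lambda>g \<in> carrier G. cinv B (lunit B (Th W A g)) \<cdot> runit B (Th W A g))"

definition tw_comp1 :: "'a \<times> ('g \<Rightarrow> 'c) \<Rightarrow> 'a \<times> ('g \<Rightarrow> 'c) \<Rightarrow> 'a \<times> ('g \<Rightarrow> 'c)" where
  "tw_comp1 X Y = (let M = fst X; N = fst Y in
     (M \<odot> N, \<lambda>g \<in> carrier G.
        cinv B (assoc B M N (Th W (trg B N) g))
        \<cdot> (Idn B M \<star> snd Y g)
        \<cdot> assoc B M (Th W (trg B M) g) N
        \<cdot> (snd X g \<star> Idn B N)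
        \<cdot> cinv B (assoc B (Th W (src B M) g) M N)))"

definition twists :: "('o, 'a \<times> ('g \<Rightarrow> 'c),
    ('a \<times> ('g \<Rightarrow> 'c)) \<times> 'c \<times> ('a \<times> ('g \<Rightarrow> 'c))) bicat" where
  "twists =
     \<lparr>Ob = tw_cells1, Ar = tw_cells2,
      Dom = (\<lambda>(X, f, Y). X), Cod = (\<lambda>(X, f, Y). Y),
      Idn = (\<lambda>X. (X, Idn B (fst X), X)),
      Cmp = (\<lambda>(Y, g, Z) (X, f, Y'). (X, g \<cdot> f, Z)),
      Cells0 = Cells0 B,
      src = (\<lambda>X. src B (fst X)), trg = (\<lambda>X. trg B (fst X)),
      unit1 = tw_unit, comp1 = tw_comp1,
      comp2 = (\<lambda>(X, f, Y) (X', f', Y'). (tw_comp1 X X', f \<star> f', tw_comp1 Y Y')),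
      assoc = (\<lambda>X Y Z. (tw_comp1 (tw_comp1 X Y) Z, assoc B (fst X) (fst Y) (fst Z),
                         tw_comp1 X (tw_comp1 Y Z))),
      lunit = (\<lambda>X. (tw_comp1 (tw_unit (src B (fst X))) X, lunit B (fst X), X)),
      runit = (\<lambda>X. (tw_comp1 X (tw_unit (trg B (fst X))), runit B (fst X), X))\<rparr>"

text \<open>For \<open>X = (M, \<tau>) : R \<rightarrow> Q\<close> the transport map
  \<open>g\<^sub>M : M \<odot> \<Theta>\<^sub>Q(g\<^sup>-\<^sup>1) \<Rightarrow> \<Theta>\<^sub>R(g\<^sup>-\<^sup>1) \<odot> M\<close>.\<close>

definition transport :: "'g \<Rightarrow> 'a \<times> ('g \<Rightarrow> 'c) \<Rightarrow> 'c" where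
  "transport g X = cinv B (snd X (inv\<^bsub>G\<^esub> g))"

text \<open>The left twist of a 1-cell \<open>M\<close>, which is \<open>\<Theta>(g\<^sup>-\<^sup>1) \<odot> M\<close> with \<open>\<Theta>\<close> taken at the source of \<open>M\<close>.\<close>

definition ltwist :: "'g \<Rightarrow> 'a \<Rightarrow> 'a" where
  "ltwist g M = Th W (src B M) (inv\<^bsub>G\<^esub> g) \<odot> M"

end


section \<open>Twisted cyclicity and conjugation transport\<close>

context
  fixes B :: "('o, 'a, 'c, 'z) bicat_scheme" (structure)
    and G :: "('g, 'y) monoid_scheme"
    and W :: "('o, 'g, 'a, 'c) twisting"
    and T :: "('x, 't, 'w) cat_scheme"
    and S :: "('a, 'c, 'x, 't) shadow_data"
begin

definition tw_shadow :: "'g \<Rightarrow> 'a \<times> ('g \<Rightarrow> 'c) \<Rightarrow> 'x" where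
  "tw_shadow g X = shO S (ltwist B G W g (fst X))"

definition tw_theta :: "'g \<Rightarrow> 'a \<times> ('g \<Rightarrow> 'c) \<Rightarrow> 'a \<times> ('g \<Rightarrow> 'c) \<Rightarrow> 't" where
  "tw_theta g X Y = (let M = fst X; N = fst Y;
       tR = Th W (src B M) (inv\<^bsub>G\<^esub> g); tQ = Th W (src B N) (inv\<^bsub>G\<^esub> g) in
     shA S (assoc B tQ N M)
     \<cdot>\<^bsub>T\<^esub> shA S (transport B G g Y \<star> Idn B M)
     \<cdot>\<^bsub>T\<^esub> shA S (cinv B (assoc B N tR M))
     \<cdot>\<^bsub>T\<^esub> theta S (tR \<odot> M) N
     \<cdot>\<^bsub>T\<^esub> shA S (cinv B (assoc B tR M N)))"

text \<open>The bracketings met along the composite, with \<open>t = \<Theta>(g\<^sup>-\<^sup>1)\<close>, \<open>u = \<Theta>(h\<^sup>-\<^sup>1)\<close>,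
  \<open>s = \<Theta>(h)\<close>: first
  \<open>t \<odot> M\<close>, \<open>(t \<odot> M) \<odot> U\<close>, \<open>(t \<odot> M) \<odot> \<Theta>(e)\<close>, \<open>(t \<odot> M) \<odot> (u \<odot> s)\<close>, \<open>((t \<odot> M) \<odot> u) \<odot> s\<close>;
  after \<open>\<theta>\<close>
  \<open>s \<odot> ((t \<odot> M) \<odot> u)\<close>, \<open>s \<odot> (t \<odot> (M \<odot> u))\<close>, \<open>s \<odot> (t \<odot> (u \<odot> M))\<close>,
  \<open>(s \<odot> t) \<odot> (u \<odot> M)\<close>, \<open>((s \<odot> t) \<odot> u) \<odot> M\<close>, \<open>\<Theta>(h g\<^sup>-\<^sup>1 h\<^sup>-\<^sup>1) \<odot> M\<close>.\<close>

definition conj_transport :: "'g \<Rightarrow> 'g \<Rightarrow> 'a \<times> ('g \<Rightarrow> 'c) \<Rightarrow> 't" where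
  "conj_transport h g X = (let M = fst X; R = src B M;
       g' = inv\<^bsub>G\<^esub> g; h' = inv\<^bsub>G\<^esub> h;
       t = Th W R g'; u = Th W R h'; s = Th W R h in
     shA S ((Mu W R (h \<otimes>\<^bsub>G\<^esub> g') h' \<cdot> (Mu W R h g' \<star> Idn B u)) \<star> Idn B M)
     \<cdot>\<^bsub>T\<^esub> shA S (cinv B (assoc B (s \<odot> t) u M) \<cdot> cinv B (assoc B s t (u \<odot> M)))
     \<cdot>\<^bsub>T\<^esub> shA S (Idn B s \<star> (Idn B t \<star> transport B G h X))
     \<cdot>\<^bsub>T\<^esub> shA S (Idn B s \<star> assoc B t M u)
     \<cdot>\<^bsub>T\<^esub> theta S ((t \<odot> M) \<odot> u) s
     \<cdot>\<^bsub>T\<^esub> shA S (cinv B (assoc B (t \<odot> M) u s)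
               \<cdot> (Idn B (t \<odot> M) \<star> (cinv B (Mu W R h' h) \<cdot> Eta W R))
               \<cdot> cinv B (runit B (t \<odot> M))))"

end

end

theory Submission
  imports Defs
begin

text \<open>
  Write \<open>t = \<Theta>(g\<^sup>-\<^sup>1)\<close> and \<open>X = M \<odot> N\<close>, and for an endo-1-cell \<open>(X, \<tau>)\<close> of twists let
  \<open>rotation b\<close> be the automorphism of the shadow of \<open>\<Theta>(b) \<odot> X\<close> that brings \<open>\<Theta>(b)\<close> once around
  the circle by \<open>\<theta>\<close> and then back through \<open>X\<close> by \<open>\<tau> b\<close> inverse. Both operators of the
  theorem are the rotation for \<open>b = g\<^sup>-\<^sup>1\<close>.

  For \<open>\<Psi>\<close>, the hexagon splits the first cyclicity into one that moves \<open>t\<close> and one that moves \<open>M\<close>.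
  Once naturality has taken the transport map \<open>g\<^sub>N\<close> out of the way, the latter meets the second
  cyclicity and they cancel, because \<open>\<theta> \<circ> \<theta>\<close> is the identity (\<open>theta_theta\<close>). This leaves the
  cyclicity of \<open>t\<close> followed by \<open>g\<^sub>N\<close> and \<open>g\<^sub>M\<close>, which make up the transport map of \<open>M \<odot> N\<close>
  (\<open>twofold_tw_theta\<close>).

  For the conjugation transport, the hexagon and the unit law of the shadow allow the pair
  \<open>\<Theta>(g\<^sup>-\<^sup>1) \<odot> \<Theta>(g)\<close> to be inserted on the left of \<open>t \<odot> X\<close> instead, after which only its first member
  is sent around. The second member cancels with \<open>t\<close>, so the first has made the rotation in place of
  \<open>t\<close>. What remains is a triangle identity for the inverse 1-cells \<open>\<Theta>(g\<^sup>-\<^sup>1)\<close> and \<open>\<Theta>(g)\<close> (\<open>conj_transport_eq_rotation\<close>).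

  For the order, let \<open>partial_rotation b c\<close> split \<open>\<Theta>(b c)\<close> into \<open>\<Theta>(b) \<odot> \<Theta>(c)\<close>, send only \<open>\<Theta>(b)\<close>
  around, and multiply again to \<open>\<Theta>(c b)\<close>. The hexagon and the multiplicativity of \<open>\<tau>\<close> give
  \<open>partial_rotation (b d) c = partial_rotation d (c b) \<circ> partial_rotation b (d c)\<close>. So
  \<open>partial_rotation 1 c\<close> is idempotent, and being invertible it is the identity. The \<open>n\<close>-th power
  of \<open>rotation b = partial_rotation b 1\<close> is \<open>partial_rotation b\<^sup>n b\<^sup>1\<^sup>-\<^sup>n\<close>, hence the identity as soon
  as \<open>b\<^sup>n = 1\<close>.

  The multiplicativity of \<open>\<tau>\<close> for the composite \<open>M \<odot> N\<close> is \<open>half_braiding_comp\<close>. To keep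
  associators under control, the multiplication of \<open>\<Theta>\<close> and the maps \<open>\<tau> b\<close> are used in the form in
  which they operate on a right-bracketed product with an arbitrary tail \<open>P\<close> (\<open>act_mult\<close>,
  \<open>act_unit\<close>, \<open>slide\<close>), where the laws contain no associators.
\<close>

section \<open>Isomorphisms in a category\<close>

definition is_iso :: "('x, 't, 'z) cat_scheme \<Rightarrow> 't \<Rightarrow> bool" where
  "is_iso C f \<longleftrightarrow> f \<in> isos C (Dom C f) (Cod C f)"

context category
begin

lemma Dom_in [simp]: "f \<in> Ar C \<Longrightarrow> Dom C f \<in> Ob C"
  and Cod_in [simp]: "f \<in> Ar C \<Longrightarrow> Cod C f \<in> Ob C"
  by (rule dom_in cod_in, assumption)+

lemma Idn_simps [simp]:
  assumes "x \<in> Ob C"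
  shows "Idn C x \<in> Ar C" "Dom C (Idn C x) = x" "Cod C (Idn C x) = x"
  using idn_in[OF assms] by (auto simp: arrs_def)

lemma Cmp_simps [simp]:
  assumes "f \<in> Ar C" "g \<in> Ar C" "Dom C g = Cod C f"
  shows "g \<cdot> f \<in> Ar C" "Dom C (g \<cdot> f) = Dom C f" "Cod C (g \<cdot> f) = Cod C g"
  using cmp_in[of f "Dom C f" "Cod C f" g "Cod C g"] assms by (auto simp: arrs_def)

lemma Cmp_Idn [simp]: "f \<in> Ar C \<Longrightarrow> x = Dom C f \<Longrightarrow> f \<cdot> Idn C x = f"
  and Idn_Cmp [simp]: "f \<in> Ar C \<Longrightarrow> x = Cod C f \<Longrightarrow> Idn C x \<cdot> f = f"
  using cmp_idn[of f] idn_cmp[of f] by (auto simp: arrs_def)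

lemma Cmp_assoc:
  assumes "f \<in> Ar C" "g \<in> Ar C" "h \<in> Ar C" "Dom C g = Cod C f" "Dom C h = Cod C g"
  shows "(h \<cdot> g) \<cdot> f = h \<cdot> (g \<cdot> f)"
  using cmp_assoc[of f "Dom C f" "Cod C f" g "Cod C g" h "Cod C h"] assms
  by (auto simp: arrs_def)

lemma is_isoI:
  assumes "f \<in> Ar C" "k \<in> Ar C" "Dom C k = Cod C f" "Cod C k = Dom C f"
    "k \<cdot> f = Idn C (Dom C f)" "f \<cdot> k = Idn C (Cod C f)"
  shows "is_iso C f"
  using assms by (auto simp: is_iso_def isos_def arrs_def)

lemma is_iso_of_isos:
  "f \<in> isos C x y \<Longrightarrow> is_iso C f \<and> f \<in> Ar C \<and> Dom C f = x \<and> Cod C f = y"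
  by (auto simp: is_iso_def isos_def arrs_def)

lemma isos_iff: "f \<in> isos C x y \<longleftrightarrow> is_iso C f \<and> Dom C f = x \<and> Cod C f = y"
  by (auto simp: is_iso_def isos_def arrs_def)

lemma inverse_unique:
  assumes "f \<in> Ar C" "k \<in> Ar C" "k' \<in> Ar C" "Dom C k = Cod C f" "Cod C k = Dom C f"
    "Dom C k' = Cod C f" "k \<cdot> f = Idn C (Dom C f)" "f \<cdot> k' = Idn C (Cod C f)" "Cod C k' = Dom C f"
  shows "k = k'"
proof -
  have "k = k \<cdot> (f \<cdot> k')" using assms by simp
  also have "\<dots> = (k \<cdot> f) \<cdot> k'" using assms by (subst Cmp_assoc) simp_all
  also have "\<dots> = k'" using assms by simp
  finally show ?thesis .
qed

lemma cinv_eqI: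
  assumes "f \<in> Ar C" "k \<in> Ar C" "Dom C k = Cod C f" "Cod C k = Dom C f"
    "k \<cdot> f = Idn C (Dom C f)" "f \<cdot> k = Idn C (Cod C f)"
  shows "cinv C f = k"
  unfolding cinv_def
proof (rule the_equality)
  show "k \<in> arrs C (Cod C f) (Dom C f) \<and> k \<cdot> f = Idn C (Dom C f) \<and> f \<cdot> k = Idn C (Cod C f)"
    using assms by (simp add: arrs_def)
next
  fix k' assume "k' \<in> arrs C (Cod C f) (Dom C f) \<and> k' \<cdot> f = Idn C (Dom C f) \<and> f \<cdot> k' = Idn C (Cod C f)"
  then show "k' = k" using assms by (intro inverse_unique[of f k' k]) (auto simp: arrs_def)
qed

lemma cinv_simps [simp]:
  assumes "is_iso C f"
  shows "cinv C f \<in> Ar C" "Dom C (cinv C f) = Cod C f" "Cod C (cinv C f) = Dom C f"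
    "cinv C f \<cdot> f = Idn C (Dom C f)" "f \<cdot> cinv C f = Idn C (Cod C f)"
    "is_iso C (cinv C f)"
proof -
  from assms obtain k where k: "f \<in> Ar C" "k \<in> Ar C" "Dom C k = Cod C f" "Cod C k = Dom C f"
    "k \<cdot> f = Idn C (Dom C f)" "f \<cdot> k = Idn C (Cod C f)"
    by (auto simp: is_iso_def isos_def arrs_def)
  then have "cinv C f = k" by (rule cinv_eqI)
  moreover have "is_iso C k" by (rule is_isoI[of k f]) (use k in simp_all)
  ultimately show "cinv C f \<in> Ar C" "Dom C (cinv C f) = Cod C f" "Cod C (cinv C f) = Dom C f"
    "cinv C f \<cdot> f = Idn C (Dom C f)" "f \<cdot> cinv C f = Idn C (Cod C f)"
    "is_iso C (cinv C f)"
    using k by simp_all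
qed

lemma cinv_cancel [simp]:
  assumes "is_iso C f" "f \<in> Ar C" "x \<in> Ar C"
  shows "Cod C x = Dom C f \<Longrightarrow> cinv C f \<cdot> (f \<cdot> x) = x"
    "Cod C x = Cod C f \<Longrightarrow> f \<cdot> (cinv C f \<cdot> x) = x"
  using assms by (simp_all add: Cmp_assoc[symmetric])

lemma is_iso_Idn [simp]: "x \<in> Ob C \<Longrightarrow> is_iso C (Idn C x)"
  by (rule is_isoI[of _ "Idn C x"]) simp_all

lemma is_iso_Cmp [simp]:
  assumes "is_iso C f" "is_iso C g" "f \<in> Ar C" "g \<in> Ar C" "Dom C g = Cod C f"
  shows "is_iso C (g \<cdot> f)"
  by (rule is_isoI[of _ "cinv C f \<cdot> cinv C g"]) (use assms in \<open>simp_all add: Cmp_assoc\<close>)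

lemma cinv_Cmp:
  assumes "is_iso C f" "is_iso C g" "f \<in> Ar C" "g \<in> Ar C" "Dom C g = Cod C f"
  shows "cinv C (g \<cdot> f) = cinv C f \<cdot> cinv C g"
  by (rule cinv_eqI) (use assms in \<open>simp_all add: Cmp_assoc\<close>)

lemma cinv_cinv [simp]: "is_iso C f \<Longrightarrow> f \<in> Ar C \<Longrightarrow> cinv C (cinv C f) = f"
  by (rule cinv_eqI) simp_all

lemma cinv_eq_right_inverse:
  assumes "is_iso C f" "f \<in> Ar C" "k \<in> Ar C" "Cod C k = Dom C f" "f \<cdot> k = Idn C (Cod C f)"
  shows "cinv C f = k"
proof -
  have "cinv C f \<cdot> (f \<cdot> k) = cinv C f" using assms(1,2) unfolding assms(5) by simp
  then show ?thesis using assms(1-4) by simp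
qed

lemma iso_cancel_right:
  assumes "is_iso C f" "f \<in> Ar C" "x \<in> Ar C" "y \<in> Ar C" "Dom C x = Cod C f" "Dom C y = Cod C f"
    "x \<cdot> f = y \<cdot> f"
  shows "x = y"
proof -
  have "(x \<cdot> f) \<cdot> cinv C f = (y \<cdot> f) \<cdot> cinv C f" using assms by simp
  then show ?thesis using assms(1-6) by (simp add: Cmp_assoc)
qed

lemma iso_cancel_left:
  assumes "is_iso C f" "f \<in> Ar C" "x \<in> Ar C" "y \<in> Ar C" "Cod C x = Dom C f" "Cod C y = Dom C f"
    "f \<cdot> x = f \<cdot> y"
  shows "x = y"
proof -
  have "cinv C f \<cdot> (f \<cdot> x) = cinv C f \<cdot> (f \<cdot> y)" using assms by simp
  then show ?thesis using assms(1-6) by simp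
qed

text \<open>Composites are kept right-nested, where \<open>p \<cdot> q\<close> is not a subterm of \<open>p \<cdot> (q \<cdot> x)\<close>; this form
  lets a two-step equation be used inside a longer path.\<close>
lemma Cmp_replace:
  assumes "p \<cdot> q = r" "q \<in> Ar C" "p \<in> Ar C" "x \<in> Ar C" "Dom C p = Cod C q" "Dom C q = Cod C x"
  shows "p \<cdot> (q \<cdot> x) = r \<cdot> x"
  using assms Cmp_assoc[of x q p] by simp

text \<open>Inverting opposite sides of a commuting square: this turns naturality of a structure map into
  naturality of its inverse.\<close>
lemma cinv_swap:
  assumes "p \<cdot> q = r \<cdot> s" "is_iso C p" "is_iso C s" "p \<in> Ar C" "s \<in> Ar C" "q \<in> Ar C" "r \<in> Ar C"
    "Dom C p = Cod C q" "Dom C r = Cod C s" 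
  shows "q \<cdot> cinv C s = cinv C p \<cdot> r"
proof -
  have e: "Dom C q = Dom C s" "Cod C p = Cod C r" 
    using assms(1,4-9) Cmp_simps[of q p] Cmp_simps[of s r] by auto
  have "cinv C p \<cdot> ((p \<cdot> q) \<cdot> cinv C s) = cinv C p \<cdot> ((r \<cdot> s) \<cdot> cinv C s)" using assms by simp
  then show ?thesis using assms(2-9) e by (simp add: Cmp_assoc)
qed

end

section \<open>Coherence in a bicategory\<close>

context bicategory
begin

abbreviation lw  (infixr "\<triangleleft>" 73) where "M \<triangleleft> f \<equiv> Idn B M \<star> f"
abbreviation rw  (infixl "\<triangleright>" 72) where "f \<triangleright> M \<equiv> f \<star> Idn B M"

declare src_in [simp] trg_in [simp] src_cod [simp] trg_cod [simp]

lemma unit1_simps [simp]: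
  assumes "A \<in> Cells0 B"
  shows "U A \<in> Ob B" "src B (U A) = A" "trg B (U A) = A"
  using unit1_in[OF assms] by (auto simp: cell1_def)

lemma comp1_simps [simp]:
  assumes "M \<in> Ob B" "N \<in> Ob B" "trg B M = src B N"
  shows "M \<odot> N \<in> Ob B" "src B (M \<odot> N) = src B M" "trg B (M \<odot> N) = trg B N"
  using comp1_in[of M "src B M" "trg B M" N "trg B N"] assms by (auto simp: cell1_def)

lemma comp2_simps [simp]:
  assumes "f \<in> Ar B" "g \<in> Ar B" "trg B (Dom B f) = src B (Dom B g)"
  shows "f \<star> g \<in> Ar B" "Dom B (f \<star> g) = Dom B f \<odot> Dom B g" "Cod B (f \<star> g) = Cod B f \<odot> Cod B g"
  using comp2_in[of f "Dom B f" "Cod B f" g "Dom B g" "Cod B g"] assms by (auto simp: arrs_def)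

lemma comp2_Idn [simp]:
  "\<lbrakk>M \<in> Ob B; N \<in> Ob B; trg B M = src B N\<rbrakk> \<Longrightarrow> Idn B M \<star> Idn B N = Idn B (M \<odot> N)"
  by (rule comp2_idn) (auto simp: cell1_def)

lemma comp2_Cmp:
  assumes "f \<in> Ar B" "f' \<in> Ar B" "g \<in> Ar B" "g' \<in> Ar B" "Dom B f' = Cod B f" "Dom B g' = Cod B g"
    "trg B (Dom B f) = src B (Dom B g)"
  shows "(f' \<star> g') \<cdot> (f \<star> g) = (f' \<cdot> f) \<star> (g' \<cdot> g)"
  using interchange[of f "Dom B f" "Cod B f" f' "Cod B f'" g "Dom B g" "Cod B g" g' "Cod B g'"] assms
  by (auto simp: arrs_def)

lemma is_iso_comp2 [simp]:
  assumes "is_iso B f" "is_iso B g" "f \<in> Ar B" "g \<in> Ar B" "trg B (Dom B f) = src B (Dom B g)"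
  shows "is_iso B (f \<star> g)"
  by (rule is_isoI[of _ "cinv B f \<star> cinv B g"]) (use assms in \<open>simp_all add: comp2_Cmp\<close>)

lemma cinv_comp2:
  assumes "is_iso B f" "is_iso B g" "f \<in> Ar B" "g \<in> Ar B" "trg B (Dom B f) = src B (Dom B g)"
  shows "cinv B (f \<star> g) = cinv B f \<star> cinv B g"
  by (rule cinv_eqI) (use assms in \<open>simp_all add: comp2_Cmp\<close>)

lemma cinv_Idn [simp]: "M \<in> Ob B \<Longrightarrow> cinv B (Idn B M) = Idn B M"
  by (rule cinv_eqI) simp_all

lemma lw_Cmp:
  assumes "f \<in> Ar B" "g \<in> Ar B" "Dom B g = Cod B f" "M \<in> Ob B" "trg B M = src B (Dom B f)"
  shows "M \<triangleleft> (g \<cdot> f) = (M \<triangleleft> g) \<cdot> (M \<triangleleft> f)"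
  using assms by (simp add: comp2_Cmp)

lemma rw_Cmp:
  assumes "f \<in> Ar B" "g \<in> Ar B" "Dom B g = Cod B f" "M \<in> Ob B" "trg B (Dom B f) = src B M"
  shows "(g \<cdot> f) \<triangleright> M = (g \<triangleright> M) \<cdot> (f \<triangleright> M)"
  using assms by (simp add: comp2_Cmp)

lemma whisker_exchange:
  assumes "f \<in> Ar B" "g \<in> Ar B" "trg B (Dom B f) = src B (Dom B g)"
  shows "(Cod B f \<triangleleft> g) \<cdot> (f \<triangleright> Dom B g) = (f \<triangleright> Cod B g) \<cdot> (Dom B f \<triangleleft> g)"
  using assms by (simp add: comp2_Cmp)

lemma assoc_simps [simp]:
  assumes "M \<in> Ob B" "N \<in> Ob B" "P \<in> Ob B" "trg B M = src B N" "trg B N = src B P"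
  shows "assoc B M N P \<in> Ar B" "Dom B (assoc B M N P) = (M \<odot> N) \<odot> P"
    "Cod B (assoc B M N P) = M \<odot> (N \<odot> P)" "is_iso B (assoc B M N P)"
  using is_iso_of_isos[OF assoc_iso[of M "src B M" "trg B M" N "trg B N" P "trg B P"]] assms
  by (auto simp: cell1_def)

lemma lunit_simps [simp]:
  assumes "M \<in> Ob B"
  shows "lunit B M \<in> Ar B" "Dom B (lunit B M) = U (src B M) \<odot> M" "Cod B (lunit B M) = M"
    "is_iso B (lunit B M)"
  using is_iso_of_isos[OF lunit_iso[of M "src B M" "trg B M"]] assms by (auto simp: cell1_def)

lemma runit_simps [simp]:
  assumes "M \<in> Ob B"
  shows "runit B M \<in> Ar B" "Dom B (runit B M) = M \<odot> U (trg B M)" "Cod B (runit B M) = M"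
    "is_iso B (runit B M)"
  using is_iso_of_isos[OF runit_iso[of M "src B M" "trg B M"]] assms by (auto simp: cell1_def)

lemma assoc_nat:
  assumes "f \<in> Ar B" "g \<in> Ar B" "h \<in> Ar B"
    "trg B (Dom B f) = src B (Dom B g)" "trg B (Dom B g) = src B (Dom B h)"
    "M' = Cod B f" "N' = Cod B g" "P' = Cod B h"
  shows "assoc B M' N' P' \<cdot> ((f \<star> g) \<star> h)
    = (f \<star> (g \<star> h)) \<cdot> assoc B (Dom B f) (Dom B g) (Dom B h)"
  using assoc_natural[of f "Dom B f" M' g "Dom B g" N' h "Dom B h" P'] assms by (auto simp: arrs_def)

lemma lunit_nat:
  "f \<in> Ar B \<Longrightarrow> A = src B (Dom B f) \<Longrightarrow> lunit B (Cod B f) \<cdot> (U A \<triangleleft> f) = f \<cdot> lunit B (Dom B f)"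
  using lunit_natural[of f "Dom B f" "Cod B f" "src B (Dom B f)" "trg B (Dom B f)"]
  by (auto simp: arrs_def cell1_def)

lemma runit_nat:
  "f \<in> Ar B \<Longrightarrow> A = trg B (Dom B f) \<Longrightarrow> runit B (Cod B f) \<cdot> (f \<triangleright> U A) = f \<cdot> runit B (Dom B f)"
  using runit_natural[of f "Dom B f" "Cod B f" "src B (Dom B f)" "trg B (Dom B f)"]
  by (auto simp: arrs_def cell1_def)

lemma pentagon':
  assumes "M \<in> Ob B" "N \<in> Ob B" "P \<in> Ob B" "Q \<in> Ob B"
    "trg B M = src B N" "trg B N = src B P" "trg B P = src B Q"
  shows "(M \<triangleleft> assoc B N P Q) \<cdot> (assoc B M (N \<odot> P) Q \<cdot> (assoc B M N P \<triangleright> Q))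
       = assoc B M N (P \<odot> Q) \<cdot> assoc B (M \<odot> N) P Q"
  using pentagon[of M "src B M" "trg B M" N "trg B N" P "trg B P" Q "trg B Q"] assms
  by (simp add: cell1_def)

lemma triangle':
  assumes "M \<in> Ob B" "N \<in> Ob B" "trg B M = src B N" "A = src B N"
  shows "(M \<triangleleft> lunit B N) \<cdot> assoc B M (U A) N = runit B M \<triangleright> N"
  using triangle[of M "src B M" "trg B M" N "trg B N"] assms by (simp add: cell1_def)

text \<open>The left unitor is a natural isomorphism from whiskering with the unit to the identity, so
  this whiskering is injective on 2-cells.\<close>
lemma lw_unit_faithful:
  assumes "f \<in> Ar B" "g \<in> Ar B" "Dom B f = Dom B g" "Cod B f = Cod B g" "A = src B (Dom B g)"
    "U A \<triangleleft> f = U A \<triangleleft> g"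
  shows "f = g"
proof -
  have "f \<cdot> lunit B (Dom B g) = g \<cdot> lunit B (Dom B g)"
    using lunit_nat[of f A] lunit_nat[of g A] assms by simp
  then show ?thesis using assms by (intro iso_cancel_right[of "lunit B (Dom B g)" f g]) simp_all
qed

lemma rw_unit_faithful:
  assumes "f \<in> Ar B" "g \<in> Ar B" "Dom B f = Dom B g" "Cod B f = Cod B g" "A = trg B (Dom B g)"
    "f \<triangleright> U A = g \<triangleright> U A"
  shows "f = g"
proof -
  have "f \<cdot> runit B (Dom B g) = g \<cdot> runit B (Dom B g)"
    using runit_nat[of f A] runit_nat[of g A] assms by simp
  then show ?thesis using assms by (intro iso_cancel_right[of "runit B (Dom B g)" f g]) simp_all
qed

text \<open>Kelly's derivation of the unit coherence that is not among the axioms: whiskered with a further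
  unit, the equation follows from the pentagon for \<open>U, U, M, N\<close> and the triangle, and such a
  whiskering can be undone.\<close>
lemma lunit_comp1:
  assumes [simp]: "M \<in> Ob B" "N \<in> Ob B" "trg B M = src B N" and A: "A = src B M"
  shows "lunit B (M \<odot> N) \<cdot> assoc B (U A) M N = lunit B M \<triangleright> N"
proof (rule lw_unit_faithful[where A = A])
  let ?U = "U (src B M)"
  let ?p = "assoc B ?U (?U \<odot> M) N \<cdot> (assoc B ?U ?U M \<triangleright> N)"
  have "(?U \<triangleleft> (lunit B (M \<odot> N) \<cdot> assoc B ?U M N)) \<cdot> ?p
      = (?U \<triangleleft> lunit B (M \<odot> N)) \<cdot> ((?U \<triangleleft> assoc B ?U M N) \<cdot> ?p)"
    by (simp add: lw_Cmp Cmp_assoc)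
  also have "\<dots> = (?U \<triangleleft> lunit B (M \<odot> N)) \<cdot> (assoc B ?U ?U (M \<odot> N) \<cdot> assoc B (?U \<odot> ?U) M N)"
    by (simp add: pentagon')
  also have "\<dots> = (runit B ?U \<triangleright> (M \<odot> N)) \<cdot> assoc B (?U \<odot> ?U) M N"
    by (simp add: Cmp_assoc[symmetric] triangle')
  also have "\<dots> = assoc B ?U M N \<cdot> ((runit B ?U \<triangleright> M) \<triangleright> N)"
    by (subst assoc_nat) simp_all
  also have "\<dots> = assoc B ?U M N \<cdot> (((?U \<triangleleft> lunit B M) \<cdot> assoc B ?U ?U M) \<triangleright> N)"
    by (simp add: triangle')
  also have "\<dots> = (assoc B ?U M N \<cdot> ((?U \<triangleleft> lunit B M) \<triangleright> N)) \<cdot> (assoc B ?U ?U M \<triangleright> N)"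
    by (simp add: rw_Cmp Cmp_assoc)
  also have "\<dots> = (?U \<triangleleft> (lunit B M \<triangleright> N)) \<cdot> ?p"
    by (simp add: assoc_nat Cmp_assoc)
  finally have "?U \<triangleleft> (lunit B (M \<odot> N) \<cdot> assoc B ?U M N) = ?U \<triangleleft> (lunit B M \<triangleright> N)"
    by (rule iso_cancel_right[of ?p, rotated -1]) simp_all
  then show "U A \<triangleleft> (lunit B (M \<odot> N) \<cdot> assoc B (U A) M N) = U A \<triangleleft> (lunit B M \<triangleright> N)" by (simp add: A)
qed (simp_all add: A)

text \<open>The mirror image, from the pentagon for \<open>M, N, U, U\<close>.\<close>
lemma runit_comp1:
  assumes [simp]: "M \<in> Ob B" "N \<in> Ob B" "trg B M = src B N" and A: "A = trg B N"
  shows "(M \<triangleleft> runit B N) \<cdot> assoc B M N (U A) = runit B (M \<odot> N)"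
proof (rule rw_unit_faithful[where A = A])
  let ?U = "U (trg B N)"
  let ?a = "assoc B M N ?U"
  have "?a \<cdot> (((M \<triangleleft> runit B N) \<cdot> ?a) \<triangleright> ?U) = (?a \<cdot> ((M \<triangleleft> runit B N) \<triangleright> ?U)) \<cdot> (?a \<triangleright> ?U)"
    by (simp add: rw_Cmp Cmp_assoc)
  also have "\<dots> = (M \<triangleleft> (runit B N \<triangleright> ?U)) \<cdot> (assoc B M (N \<odot> ?U) ?U \<cdot> (?a \<triangleright> ?U))"
    by (simp add: assoc_nat Cmp_assoc)
  also have "\<dots> = (M \<triangleleft> ((N \<triangleleft> lunit B ?U) \<cdot> assoc B N ?U ?U)) \<cdot> (assoc B M (N \<odot> ?U) ?U \<cdot> (?a \<triangleright> ?U))"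
    by (simp add: triangle')
  also have "\<dots> = (M \<triangleleft> (N \<triangleleft> lunit B ?U)) \<cdot> ((M \<triangleleft> assoc B N ?U ?U) \<cdot> (assoc B M (N \<odot> ?U) ?U \<cdot> (?a \<triangleright> ?U)))"
    by (simp add: lw_Cmp Cmp_assoc)
  also have "\<dots> = ((M \<triangleleft> (N \<triangleleft> lunit B ?U)) \<cdot> assoc B M N (?U \<odot> ?U)) \<cdot> assoc B (M \<odot> N) ?U ?U"
    by (simp add: pentagon' Cmp_assoc)
  also have "\<dots> = (?a \<cdot> ((M \<odot> N) \<triangleleft> lunit B ?U)) \<cdot> assoc B (M \<odot> N) ?U ?U"
    using assoc_nat[of "Idn B M" "Idn B N" "lunit B ?U"] by simp
  also have "\<dots> = ?a \<cdot> (runit B (M \<odot> N) \<triangleright> ?U)"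
    by (simp add: triangle' Cmp_assoc)
  finally have "((M \<triangleleft> runit B N) \<cdot> ?a) \<triangleright> ?U = runit B (M \<odot> N) \<triangleright> ?U"
    by (rule iso_cancel_left[of ?a, rotated -1]) simp_all
  then show "((M \<triangleleft> runit B N) \<cdot> assoc B M N (U A)) \<triangleright> U A = runit B (M \<odot> N) \<triangleright> U A" by (simp add: A)
qed (simp_all add: A)

lemma assoc_inv_nat:
  assumes "f \<in> Ar B" "g \<in> Ar B" "h \<in> Ar B"
    "trg B (Dom B f) = src B (Dom B g)" "trg B (Dom B g) = src B (Dom B h)"
    "M' = Cod B f" "N' = Cod B g" "P' = Cod B h"
  shows "cinv B (assoc B M' N' P') \<cdot> (f \<star> (g \<star> h))
    = ((f \<star> g) \<star> h) \<cdot> cinv B (assoc B (Dom B f) (Dom B g) (Dom B h))"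
  by (rule cinv_swap[symmetric]) (use assms in \<open>simp_all add: assoc_nat\<close>)

lemma cinv_lw: "\<lbrakk>is_iso B f; f \<in> Ar B; M \<in> Ob B; trg B M = src B (Dom B f)\<rbrakk>
    \<Longrightarrow> cinv B (M \<triangleleft> f) = M \<triangleleft> cinv B f"
  and cinv_rw: "\<lbrakk>is_iso B f; f \<in> Ar B; M \<in> Ob B; trg B (Dom B f) = src B M\<rbrakk>
    \<Longrightarrow> cinv B (f \<triangleright> M) = cinv B f \<triangleright> M"
  by (simp_all add: cinv_comp2)

lemma lw_rw_exchange:
  assumes "f \<in> Ar B" "g \<in> Ar B" "trg B (Dom B f) = src B (Dom B g)"
    "X = Cod B f" "Y = Dom B g" "X' = Dom B f" "Y' = Cod B g"
  shows "(X \<triangleleft> g) \<cdot> (f \<triangleright> Y) = (f \<triangleright> Y') \<cdot> (X' \<triangleleft> g)"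
  using whisker_exchange assms by simp

text \<open>The pentagon solved for the partial composites that occur when a 2-cell is moved past a
  change of brackets.\<close>
context
  fixes M N P Q
  assumes obs: "M \<in> Ob B" "N \<in> Ob B" "P \<in> Ob B" "Q \<in> Ob B"
    "trg B M = src B N" "trg B N = src B P" "trg B P = src B Q"
begin

lemma pentagon_split:
  "assoc B (M \<odot> N) P Q \<cdot> (cinv B (assoc B M N P) \<triangleright> Q)
    = cinv B (assoc B M N (P \<odot> Q)) \<cdot> ((M \<triangleleft> assoc B N P Q) \<cdot> assoc B M (N \<odot> P) Q)"
proof -
  let ?r = "assoc B M N P \<triangleright> Q"
  have "assoc B (M \<odot> N) P Q = cinv B (assoc B M N (P \<odot> Q)) \<cdot> ((M \<triangleleft> assoc B N P Q) \<cdot>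
        (assoc B M (N \<odot> P) Q \<cdot> ?r))"
    using obs by (simp add: pentagon')
  then have "assoc B (M \<odot> N) P Q \<cdot> cinv B ?r = (cinv B (assoc B M N (P \<odot> Q)) \<cdot> ((M \<triangleleft> assoc B N P Q) \<cdot>
        (assoc B M (N \<odot> P) Q \<cdot> ?r))) \<cdot> cinv B ?r"
    by simp
  then show ?thesis using obs by (simp add: Cmp_assoc cinv_rw[symmetric])
qed

lemma pentagon_nested:
  "assoc B M (N \<odot> P) Q \<cdot> (assoc B M N P \<triangleright> Q)
    = (M \<triangleleft> cinv B (assoc B N P Q)) \<cdot> (assoc B M N (P \<odot> Q) \<cdot> assoc B (M \<odot> N) P Q)"
  using obs by (simp add: pentagon'[symmetric] cinv_lw[symmetric])

lemma pentagon_inv: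
  "(assoc B M N P \<triangleright> Q) \<cdot> (cinv B (assoc B (M \<odot> N) P Q) \<cdot> cinv B (assoc B M N (P \<odot> Q)))
    = cinv B (assoc B M (N \<odot> P) Q) \<cdot> (M \<triangleleft> cinv B (assoc B N P Q))"
proof -
  have "cinv B (assoc B M N (P \<odot> Q) \<cdot> assoc B (M \<odot> N) P Q)
     = cinv B ((M \<triangleleft> assoc B N P Q) \<cdot> (assoc B M (N \<odot> P) Q \<cdot> (assoc B M N P \<triangleright> Q)))"
    using obs by (simp add: pentagon')
  then show ?thesis using obs by (simp add: cinv_Cmp cinv_lw Cmp_assoc)
qed

lemma pentagon_mixed:
  "assoc B M (N \<odot> P) Q \<cdot> ((assoc B M N P \<triangleright> Q) \<cdot> cinv B (assoc B (M \<odot> N) P Q))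
    = (M \<triangleleft> cinv B (assoc B N P Q)) \<cdot> assoc B M N (P \<odot> Q)"
  using obs by (simp add: Cmp_replace[OF pentagon_nested] Cmp_assoc)

end

text \<open>A 2-cell \<open>f\<close> that moves \<open>b\<close> through \<open>M\<close>, turning it into \<open>c\<close>, applied in front of a
  tail \<open>P\<close>: a 2-cell from \<open>b \<odot> (M \<odot> P)\<close> to \<open>M \<odot> (c \<odot> P)\<close>. Products stay bracketed to the right, so slides
  compose without associators.\<close>
definition slide where
  "slide b M c f P = assoc B M c P \<cdot> ((f \<triangleright> P) \<cdot> cinv B (assoc B b M P))"

context
  fixes b M c f
  assumes ty: "b \<in> Ob B" "M \<in> Ob B" "c \<in> Ob B" "trg B b = src B M" "trg B M = src B c"
    "f \<in> Ar B" "Dom B f = b \<odot> M" "Cod B f = M \<odot> c"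
begin

lemma slide_simps [simp]:
  assumes "P \<in> Ob B" "src B P = trg B c"
  shows "slide b M c f P \<in> Ar B" "Dom B (slide b M c f P) = b \<odot> (M \<odot> P)"
    "Cod B (slide b M c f P) = M \<odot> (c \<odot> P)" "is_iso B f \<Longrightarrow> is_iso B (slide b M c f P)"
proof -
  have "src B M = src B b" "trg B M = trg B c" 
    using trg_cod[of f] src_cod[of f] ty by auto
  then show "slide b M c f P \<in> Ar B" "Dom B (slide b M c f P) = b \<odot> (M \<odot> P)"
    "Cod B (slide b M c f P) = M \<odot> (c \<odot> P)" "is_iso B f \<Longrightarrow> is_iso B (slide b M c f P)"
    using ty assms by (simp_all add: slide_def)
qed

lemma slide_nat:
  assumes "h \<in> Ar B" "src B (Dom B h) = trg B c" "P = Dom B h" "P' = Cod B h"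
  shows "slide b M c f P' \<cdot> (b \<triangleleft> (M \<triangleleft> h)) = (M \<triangleleft> (c \<triangleleft> h)) \<cdot> slide b M c f P"
proof -
  have e: "src B M = src B b" "trg B M = trg B c" 
    using trg_cod[of f] src_cod[of f] ty by auto
  have "slide b M c f P' \<cdot> (b \<triangleleft> (M \<triangleleft> h))
    = assoc B M c P' \<cdot> ((f \<triangleright> P') \<cdot> (cinv B (assoc B b M P') \<cdot> (b \<triangleleft> (M \<triangleleft> h))))"
    using ty assms e by (simp add: slide_def Cmp_assoc)
  also have "\<dots> = assoc B M c P' \<cdot> (((f \<triangleright> P') \<cdot> ((b \<odot> M) \<triangleleft> h)) \<cdot> cinv B (assoc B b M P))"
    using ty assms e by (subst assoc_inv_nat) (simp_all add: Cmp_assoc)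
  also have "(f \<triangleright> P') \<cdot> ((b \<odot> M) \<triangleleft> h) = ((M \<odot> c) \<triangleleft> h) \<cdot> (f \<triangleright> P)"
    by (rule lw_rw_exchange[symmetric]) (use ty assms e in simp_all)
  also have "assoc B M c P' \<cdot> ((((M \<odot> c) \<triangleleft> h) \<cdot> (f \<triangleright> P)) \<cdot> cinv B (assoc B b M P))
     = (assoc B M c P' \<cdot> ((Idn B M \<star> Idn B c) \<star> h)) \<cdot> ((f \<triangleright> P) \<cdot> cinv B (assoc B b M P))"
    using ty assms e by (simp add: Cmp_assoc)
  also have "\<dots> = (M \<triangleleft> (c \<triangleleft> h)) \<cdot> slide b M c f P"
    using ty assms e by (subst assoc_nat) (simp_all add: Cmp_assoc slide_def)
  finally show ?thesis .
qed

text \<open>Two pentagons, one on either side of \<open>f\<close>, move the whiskering factor \<open>Q\<close> into the tail.\<close>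
lemma slide_rw:
  assumes "P \<in> Ob B" "src B P = trg B c" "Q \<in> Ob B" "src B Q = trg B P"
  shows "assoc B M (c \<odot> P) Q \<cdot> ((slide b M c f P \<triangleright> Q) \<cdot> cinv B (assoc B b (M \<odot> P) Q))
    = (M \<triangleleft> cinv B (assoc B c P Q)) \<cdot> (slide b M c f (P \<odot> Q) \<cdot> (b \<triangleleft> assoc B M P Q))"
proof -
  have e: "src B M = src B b" "trg B M = trg B c" "trg B b = src B b" "src B c = trg B c"
    using trg_cod[of f] src_cod[of f] ty by auto
  note [simp] = ty(1-3,6-8) assms e
  have "assoc B M (c \<odot> P) Q \<cdot> ((slide b M c f P \<triangleright> Q) \<cdot> cinv B (assoc B b (M \<odot> P) Q))
    = (assoc B M (c \<odot> P) Q \<cdot> (assoc B M c P \<triangleright> Q)) \<cdot> (((f \<triangleright> P) \<triangleright> Q) \<cdot> ((cinv B (assoc B b M P) \<triangleright> Q) \<cdot> cinv B (assoc B b (M \<odot> P) Q)))"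
    by (simp add: slide_def rw_Cmp Cmp_assoc)
  also have "\<dots> = (M \<triangleleft> cinv B (assoc B c P Q)) \<cdot> (assoc B M c (P \<odot> Q) \<cdot> 
        ((assoc B (M \<odot> c) P Q \<cdot> ((f \<triangleright> P) \<triangleright> Q)) \<cdot> ((cinv B (assoc B b M P) \<triangleright> Q) \<cdot> cinv B (assoc B b (M \<odot> P) Q))))"
    by (subst pentagon_nested) (simp_all add: Cmp_assoc)
  also have "\<dots> = (M \<triangleleft> cinv B (assoc B c P Q)) \<cdot> (assoc B M c (P \<odot> Q) \<cdot> 
        ((f \<triangleright> (P \<odot> Q)) \<cdot> ((assoc B (b \<odot> M) P Q \<cdot> (cinv B (assoc B b M P) \<triangleright> Q)) \<cdot> cinv B (assoc B b (M \<odot> P) Q))))"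
    by (subst assoc_nat) (simp_all add: Cmp_assoc)
  also have "\<dots> = (M \<triangleleft> cinv B (assoc B c P Q)) \<cdot> (slide b M c f (P \<odot> Q) \<cdot> (b \<triangleleft> assoc B M P Q))"
    by (subst pentagon_split) (simp_all add: Cmp_assoc slide_def)
  finally show ?thesis .
qed

end

end

section \<open>The action of the twisting functor on 1-cells\<close>

context twisting_data
begin

lemma Th_simps [simp]:
  assumes "A \<in> Cells0 B" "b \<in> carrier G"
  shows "Th W A b \<in> Ob B" "src B (Th W A b) = A" "trg B (Th W A b) = A"
  using Th_Pic[OF assms] by (auto simp: Pic_def cell1_def)

lemma Mu_simps [simp]:
  assumes "A \<in> Cells0 B" "b \<in> carrier G" "c \<in> carrier G"
  shows "Mu W A b c \<in> Ar B" "is_iso B (Mu W A b c)"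
    "Dom B (Mu W A b c) = Th W A b \<odot> Th W A c" "Cod B (Mu W A b c) = Th W A (b \<otimes>\<^bsub>G\<^esub> c)"
  using is_iso_of_isos[OF Mu_iso[OF assms]] by auto

lemma Eta_simps [simp]:
  assumes "A \<in> Cells0 B"
  shows "Eta W A \<in> Ar B" "is_iso B (Eta W A)"
    "Dom B (Eta W A) = U A" "Cod B (Eta W A) = Th W A \<one>\<^bsub>G\<^esub>"
  using is_iso_of_isos[OF Eta_iso[OF assms]] by auto

text \<open>The multiplication of \<open>\<Theta>\<close> acting on \<open>P\<close>, from \<open>\<Theta>(b) \<odot> (\<Theta>(c) \<odot> P)\<close> to \<open>\<Theta>(b c) \<odot> P\<close>. With \<open>act_unit\<close>
  it makes \<open>P \<mapsto> \<Theta>(b) \<odot> P\<close> an action of \<open>G\<close> up to isomorphism, whose laws are free of associators.\<close>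
definition act_mult where
  "act_mult A b c P = (Mu W A b c \<triangleright> P) \<cdot> cinv B (assoc B (Th W A b) (Th W A c) P)"

definition act_unit where
  "act_unit A P = (Eta W A \<triangleright> P) \<cdot> cinv B (lunit B P)"

context
  fixes A
  assumes A [simp]: "A \<in> Cells0 B"
begin

lemma act_mult_simps [simp]:
  assumes "b \<in> carrier G" "c \<in> carrier G" "P \<in> Ob B" "src B P = A"
  shows "act_mult A b c P \<in> Ar B" "Dom B (act_mult A b c P) = Th W A b \<odot> (Th W A c \<odot> P)"
   "Cod B (act_mult A b c P) = Th W A (b \<otimes>\<^bsub>G\<^esub> c) \<odot> P" "is_iso B (act_mult A b c P)"
  using assms by (simp_all add: act_mult_def)

lemma act_unit_simps [simp]:
  assumes "P \<in> Ob B" "src B P = A"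
  shows "act_unit A P \<in> Ar B" "Dom B (act_unit A P) = P"
   "Cod B (act_unit A P) = Th W A \<one>\<^bsub>G\<^esub> \<odot> P" "is_iso B (act_unit A P)"
  using assms by (simp_all add: act_unit_def)

lemma act_mult_nat:
  assumes "b \<in> carrier G" "c \<in> carrier G" "f \<in> Ar B" "src B (Dom B f) = A" "P = Dom B f" "P' = Cod B f"
  shows "act_mult A b c P' \<cdot> (Th W A b \<triangleleft> (Th W A c \<triangleleft> f)) = (Th W A (b \<otimes>\<^bsub>G\<^esub> c) \<triangleleft> f) \<cdot> act_mult A b c P"
proof -
  note [simp] = assms
  have "act_mult A b c P' \<cdot> (Th W A b \<triangleleft> (Th W A c \<triangleleft> f))
    = (Mu W A b c \<triangleright> P') \<cdot> (((Th W A b \<odot> Th W A c) \<triangleleft> f) \<cdot> cinv B (assoc B (Th W A b) (Th W A c) P))"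
    by (simp add: act_mult_def Cmp_assoc assoc_inv_nat)
  also have "\<dots> = ((Mu W A b c \<triangleright> P') \<cdot>
        ((Th W A b \<odot> Th W A c) \<triangleleft> f)) \<cdot> cinv B (assoc B (Th W A b) (Th W A c) P)"
    by (simp add: Cmp_assoc)
  also have "(Mu W A b c \<triangleright> P') \<cdot> ((Th W A b \<odot> Th W A c) \<triangleleft> f) = (Th W A (b \<otimes>\<^bsub>G\<^esub> c) \<triangleleft> f) \<cdot>
        (Mu W A b c \<triangleright> P)"
    by (rule lw_rw_exchange[symmetric]) simp_all
  finally show ?thesis by (simp add: act_mult_def Cmp_assoc)
qed

text \<open>This is the associativity of \<open>\<mu>\<close>; the associators of \<open>B\<close> on the two sides agree by the pentagon.\<close>
lemma act_mult_assoc: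
  assumes "b \<in> carrier G" "c \<in> carrier G" "k \<in> carrier G" "P \<in> Ob B" "src B P = A"
  shows "act_mult A (b \<otimes>\<^bsub>G\<^esub> c) k P \<cdot> act_mult A b c (Th W A k \<odot> P)
    = act_mult A b (c \<otimes>\<^bsub>G\<^esub> k) P \<cdot> (Th W A b \<triangleleft> act_mult A c k P)"
proof -
  note [simp] = assms
  let ?b = "Th W A b" let ?c = "Th W A c" let ?k = "Th W A k"
  let ?i = "\<lambda>x y z. cinv B (assoc B x y z)"
  let ?bc = "Th W A (b \<otimes>\<^bsub>G\<^esub> c)" let ?ck = "Th W A (c \<otimes>\<^bsub>G\<^esub> k)"
  have "act_mult A (b \<otimes>\<^bsub>G\<^esub> c) k P \<cdot> act_mult A b c (?k \<odot> P)
    = (Mu W A (b \<otimes>\<^bsub>G\<^esub> c) k \<triangleright> P) \<cdot> ((?i ?bc ?k P \<cdot> (Mu W A b c \<star> (Idn B ?k \<star> Idn B P))) \<cdot> ?i ?b ?c (?k \<odot> P))"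
    by (simp add: act_mult_def Cmp_assoc)
  also have "\<dots> = ((Mu W A (b \<otimes>\<^bsub>G\<^esub> c) k \<cdot> (Mu W A b c \<triangleright> ?k)) \<triangleright> P) \<cdot>
        (?i (?b \<odot> ?c) ?k P \<cdot> ?i ?b ?c (?k \<odot> P))"
    by (subst assoc_inv_nat) (simp_all add: Cmp_assoc rw_Cmp)
  also have "\<dots> = ((Mu W A b (c \<otimes>\<^bsub>G\<^esub> k) \<cdot> ((?b \<triangleleft> Mu W A c k) \<cdot> assoc B ?b ?c ?k)) \<triangleright> P) \<cdot>
        (?i (?b \<odot> ?c) ?k P \<cdot> ?i ?b ?c (?k \<odot> P))"
    by (simp add: Mu_assoc)
  also have "\<dots> = (Mu W A b (c \<otimes>\<^bsub>G\<^esub> k) \<triangleright> P) \<cdot> (((?b \<triangleleft> Mu W A c k) \<triangleright> P) \<cdot>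
       ((assoc B ?b ?c ?k \<triangleright> P) \<cdot> (?i (?b \<odot> ?c) ?k P \<cdot> ?i ?b ?c (?k \<odot> P))))"
    by (simp add: rw_Cmp Cmp_assoc G.m_assoc)
  also have "\<dots> = (Mu W A b (c \<otimes>\<^bsub>G\<^esub> k) \<triangleright> P) \<cdot> ((((?b \<triangleleft> Mu W A c k) \<triangleright> P) \<cdot>
       ?i ?b (?c \<odot> ?k) P) \<cdot> (?b \<triangleleft> ?i ?c ?k P))"
    by (simp add: pentagon_inv Cmp_assoc G.m_assoc)
  also have "((?b \<triangleleft> Mu W A c k) \<triangleright> P) \<cdot> ?i ?b (?c \<odot> ?k) P = ?i ?b ?ck P \<cdot> (?b \<triangleleft> (Mu W A c k \<triangleright> P))"
    by (subst assoc_inv_nat) simp_all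
  finally show ?thesis by (simp add: act_mult_def lw_Cmp Cmp_assoc G.m_assoc)
qed

text \<open>By one pentagon, since the action on \<open>P \<odot> Q\<close> only touches \<open>P\<close>.\<close>
lemma act_mult_rw:
  assumes "b \<in> carrier G" "c \<in> carrier G" "P \<in> Ob B" "src B P = A" "Q \<in> Ob B" "trg B P = src B Q"
  shows "act_mult A b c (P \<odot> Q) \<cdot>
        ((Th W A b \<triangleleft> assoc B (Th W A c) P Q) \<cdot> assoc B (Th W A b) (Th W A c \<odot> P) Q)
    = assoc B (Th W A (b \<otimes>\<^bsub>G\<^esub> c)) P Q \<cdot> (act_mult A b c P \<triangleright> Q)"
proof -
  note [simp] = assms
  let ?b = "Th W A b" let ?c = "Th W A c"
  let ?bc = "Th W A (b \<otimes>\<^bsub>G\<^esub> c)"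
  have "assoc B ?bc P Q \<cdot> (act_mult A b c P \<triangleright> Q)
     = (assoc B ?bc P Q \<cdot> ((Mu W A b c \<triangleright> P) \<triangleright> Q)) \<cdot> (cinv B (assoc B ?b ?c P) \<triangleright> Q)"
    by (simp add: act_mult_def rw_Cmp Cmp_assoc)
  also have "\<dots> = (Mu W A b c \<triangleright> (P \<odot> Q)) \<cdot> (assoc B (?b \<odot> ?c) P Q \<cdot> (cinv B (assoc B ?b ?c P) \<triangleright> Q))"
    by (subst assoc_nat) (simp_all add: Cmp_assoc)
  finally show ?thesis by (simp add: pentagon_split act_mult_def Cmp_assoc)
qed

lemma act_unit_nat:
  assumes "f \<in> Ar B" "src B (Dom B f) = A" "P = Dom B f" "P' = Cod B f"
  shows "act_unit A P' \<cdot> f = (Th W A \<one>\<^bsub>G\<^esub> \<triangleleft> f) \<cdot> act_unit A P"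
proof -
  note [simp] = assms
  have "cinv B (lunit B P') \<cdot> f = (U A \<triangleleft> f) \<cdot> cinv B (lunit B P)"
    by (rule cinv_swap[symmetric]) (simp_all add: lunit_nat)
  then have "act_unit A P' \<cdot> f = ((Eta W A \<triangleright> P') \<cdot> (U A \<triangleleft> f)) \<cdot> cinv B (lunit B P)"
    by (simp add: act_unit_def Cmp_assoc)
  also have "(Eta W A \<triangleright> P') \<cdot> (U A \<triangleleft> f) = (Th W A \<one>\<^bsub>G\<^esub> \<triangleleft> f) \<cdot> (Eta W A \<triangleright> P)"
    by (rule lw_rw_exchange[symmetric]) simp_all
  finally show ?thesis by (simp add: act_unit_def Cmp_assoc)
qed

lemma act_unit_rw:
  assumes "P \<in> Ob B" "src B P = A" "Q \<in> Ob B" "trg B P = src B Q"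
  shows "assoc B (Th W A \<one>\<^bsub>G\<^esub>) P Q \<cdot> (act_unit A P \<triangleright> Q) = act_unit A (P \<odot> Q)"
proof -
  note [simp] = assms
  have "assoc B (Th W A \<one>\<^bsub>G\<^esub>) P Q \<cdot> (act_unit A P \<triangleright> Q)
    = (assoc B (Th W A \<one>\<^bsub>G\<^esub>) P Q \<cdot> ((Eta W A \<triangleright> P) \<triangleright> Q)) \<cdot> (cinv B (lunit B P) \<triangleright> Q)"
    by (simp add: act_unit_def rw_Cmp Cmp_assoc)
  also have "\<dots> = (Eta W A \<triangleright> (P \<odot> Q)) \<cdot> (assoc B (U A) P Q \<cdot> cinv B (lunit B P \<triangleright> Q))"
    by (subst assoc_nat) (simp_all add: cinv_rw Cmp_assoc)
  also have "assoc B (U A) P Q \<cdot> cinv B (lunit B P \<triangleright> Q) = cinv B (lunit B (P \<odot> Q))"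
    by (simp add: lunit_comp1[symmetric] cinv_Cmp)
  finally show ?thesis by (simp add: act_unit_def)
qed

lemma act_mult_unit_left:
  assumes "b \<in> carrier G" "P \<in> Ob B" "src B P = A"
  shows "act_mult A \<one>\<^bsub>G\<^esub> b P \<cdot> act_unit A (Th W A b \<odot> P) = Idn B (Th W A b \<odot> P)"
proof -
  note [simp] = assms
  let ?b = "Th W A b" let ?e = "Th W A \<one>\<^bsub>G\<^esub>"
  let ?i = "\<lambda>x y z. cinv B (assoc B x y z)"
  have "act_mult A \<one>\<^bsub>G\<^esub> b P \<cdot> act_unit A (?b \<odot> P)
    = (Mu W A \<one>\<^bsub>G\<^esub> b \<triangleright> P) \<cdot> ((?i ?e ?b P \<cdot> (Eta W A \<star> (Idn B ?b \<star> Idn B P))) \<cdot> cinv B (lunit B (?b \<odot> P)))"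
    by (simp add: act_mult_def act_unit_def Cmp_assoc)
  also have "\<dots> = ((Mu W A \<one>\<^bsub>G\<^esub> b \<cdot> (Eta W A \<triangleright> ?b)) \<triangleright> P) \<cdot> (?i (U A) ?b P \<cdot> cinv B (lunit B (?b \<odot> P)))"
    by (subst assoc_inv_nat) (simp_all add: Cmp_assoc rw_Cmp)
  also have "\<dots> = (lunit B ?b \<triangleright> P) \<cdot> cinv B (lunit B (?b \<odot> P) \<cdot> assoc B (U A) ?b P)"
    by (simp add: Mu_lunit cinv_Cmp)
  finally show ?thesis by (simp add: lunit_comp1)
qed

lemma act_mult_unit_right:
  assumes "b \<in> carrier G" "P \<in> Ob B" "src B P = A"
  shows "act_mult A b \<one>\<^bsub>G\<^esub> P \<cdot> (Th W A b \<triangleleft> act_unit A P) = Idn B (Th W A b \<odot> P)"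
proof -
  note [simp] = assms
  let ?b = "Th W A b" let ?e = "Th W A \<one>\<^bsub>G\<^esub>"
  let ?i = "\<lambda>x y z. cinv B (assoc B x y z)"
  have "act_mult A b \<one>\<^bsub>G\<^esub> P \<cdot> (?b \<triangleleft> act_unit A P)
    = (Mu W A b \<one>\<^bsub>G\<^esub> \<triangleright> P) \<cdot> ((?i ?b ?e P \<cdot> (?b \<triangleleft> (Eta W A \<triangleright> P))) \<cdot> (?b \<triangleleft> cinv B (lunit B P)))"
    by (simp add: act_mult_def act_unit_def Cmp_assoc lw_Cmp)
  also have "\<dots> = ((Mu W A b \<one>\<^bsub>G\<^esub> \<cdot> (?b \<triangleleft> Eta W A)) \<triangleright> P) \<cdot> (?i ?b (U A) P \<cdot> cinv B (?b \<triangleleft> lunit B P))"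
    by (subst assoc_inv_nat) (simp_all add: Cmp_assoc rw_Cmp cinv_lw)
  also have "\<dots> = (runit B ?b \<triangleright> P) \<cdot> cinv B ((?b \<triangleleft> lunit B P) \<cdot> assoc B ?b (U A) P)"
    by (simp add: Mu_runit cinv_Cmp)
  finally show ?thesis by (simp add: triangle')
qed

end

section \<open>Half-braidings and their composition\<close>

text \<open>The multiplicativity of \<open>\<tau>\<close> required of a 1-cell of twists, with its associators absorbed into
  \<open>act_mult\<close> on the left and \<open>slide\<close> on the right: moving \<open>\<Theta>(b c)\<close> through \<open>M\<close> is moving \<open>\<Theta>(c)\<close> and
  then \<open>\<Theta>(b)\<close>.\<close>
definition half_braiding where
  "half_braiding R Q M \<tau> \<longleftrightarrow> M \<in> Ob B \<and> src B M = R \<and> trg B M = Q \<and>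
     (\<forall>b \<in> carrier G. \<tau> b \<in> isos B (Th W R b \<odot> M) (M \<odot> Th W Q b)) \<and>
     (\<forall>b \<in> carrier G. \<forall>c \<in> carrier G. \<tau> (b \<otimes>\<^bsub>G\<^esub> c) \<cdot> act_mult R b c M
        = (M \<triangleleft> Mu W Q b c) \<cdot> (slide (Th W R b) M (Th W Q b) (\<tau> b) (Th W Q c) \<cdot> (Th W R b \<triangleleft> \<tau> c)))"

lemma half_braiding_simps:
  assumes "half_braiding R Q M \<tau>"
  shows "M \<in> Ob B" "src B M = R" "trg B M = Q" "R \<in> Cells0 B" "Q \<in> Cells0 B"
    "b \<in> carrier G \<Longrightarrow> \<tau> b \<in> Ar B" "b \<in> carrier G \<Longrightarrow> is_iso B (\<tau> b)"
    "b \<in> carrier G \<Longrightarrow> Dom B (\<tau> b) = Th W R b \<odot> M" "b \<in> carrier G \<Longrightarrow> Cod B (\<tau> b) = M \<odot> Th W Q b"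
    "\<lbrakk>b \<in> carrier G; P \<in> Ob B; src B P = Q\<rbrakk> \<Longrightarrow> slide (Th W R b) M (Th W Q b) (\<tau> b) P \<in> Ar B"
    "\<lbrakk>b \<in> carrier G; P \<in> Ob B; src B P = Q\<rbrakk>
      \<Longrightarrow> Dom B (slide (Th W R b) M (Th W Q b) (\<tau> b) P) = Th W R b \<odot> (M \<odot> P)"
    "\<lbrakk>b \<in> carrier G; P \<in> Ob B; src B P = Q\<rbrakk>
      \<Longrightarrow> Cod B (slide (Th W R b) M (Th W Q b) (\<tau> b) P) = M \<odot> (Th W Q b \<odot> P)"
    "\<lbrakk>b \<in> carrier G; P \<in> Ob B; src B P = Q\<rbrakk>
      \<Longrightarrow> is_iso B (slide (Th W R b) M (Th W Q b) (\<tau> b) P)"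
proof -
  show 1: "M \<in> Ob B" "src B M = R" "trg B M = Q" "R \<in> Cells0 B" "Q \<in> Cells0 B"
    using assms src_in[of M] trg_in[of M] by (auto simp: half_braiding_def)
  have 2: "\<tau> b \<in> Ar B \<and> is_iso B (\<tau> b) \<and> Dom B (\<tau> b) = Th W R b \<odot> M \<and> Cod B (\<tau> b) = M \<odot> Th W Q b"
    if "b \<in> carrier G" for b
    using assms that is_iso_of_isos unfolding half_braiding_def by blast
  show "b \<in> carrier G \<Longrightarrow> \<tau> b \<in> Ar B" "b \<in> carrier G \<Longrightarrow> is_iso B (\<tau> b)"
    "b \<in> carrier G \<Longrightarrow> Dom B (\<tau> b) = Th W R b \<odot> M" "b \<in> carrier G \<Longrightarrow> Cod B (\<tau> b) = M \<odot> Th W Q b"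
    using 2 by auto
  show "\<lbrakk>b \<in> carrier G; P \<in> Ob B; src B P = Q\<rbrakk> \<Longrightarrow> slide (Th W R b) M (Th W Q b) (\<tau> b) P \<in> Ar B"
    "\<lbrakk>b \<in> carrier G; P \<in> Ob B; src B P = Q\<rbrakk>
      \<Longrightarrow> Dom B (slide (Th W R b) M (Th W Q b) (\<tau> b) P) = Th W R b \<odot> (M \<odot> P)"
    "\<lbrakk>b \<in> carrier G; P \<in> Ob B; src B P = Q\<rbrakk>
      \<Longrightarrow> Cod B (slide (Th W R b) M (Th W Q b) (\<tau> b) P) = M \<odot> (Th W Q b \<odot> P)"
    "\<lbrakk>b \<in> carrier G; P \<in> Ob B; src B P = Q\<rbrakk>
      \<Longrightarrow> is_iso B (slide (Th W R b) M (Th W Q b) (\<tau> b) P)"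
    using 1 2 by simp_all
qed

lemma half_braiding_Mu:
  assumes "half_braiding R Q M \<tau>" "b \<in> carrier G" "c \<in> carrier G"
  shows "\<tau> (b \<otimes>\<^bsub>G\<^esub> c) \<cdot> act_mult R b c M
        = (M \<triangleleft> Mu W Q b c) \<cdot> (slide (Th W R b) M (Th W Q b) (\<tau> b) (Th W Q c) \<cdot> (Th W R b \<triangleleft> \<tau> c))"
  using assms unfolding half_braiding_def by blast

lemma half_braiding_cong:
  assumes "\<And>b. b \<in> carrier G \<Longrightarrow> \<tau> b = \<sigma> b"
  shows "half_braiding R Q M \<tau> \<longleftrightarrow> half_braiding R Q M \<sigma>"
  unfolding half_braiding_def using assms by simp

text \<open>The multiplicativity of \<open>\<tau>\<close> in front of a tail \<open>P\<close>. It is the defining law whiskered with \<open>P\<close>,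
  once both sides are composed with the reassociation out of \<open>(\<Theta>(b) \<odot> (\<Theta>(c) \<odot> M)) \<odot> P\<close>.\<close>
lemma half_braiding_mult:
  assumes hb: "half_braiding R Q M \<tau>" and [simp]: "b \<in> carrier G" "c \<in> carrier G" "P \<in> Ob B" "src B P = Q"
  shows "slide (Th W R (b \<otimes>\<^bsub>G\<^esub> c)) M (Th W Q (b \<otimes>\<^bsub>G\<^esub> c)) (\<tau> (b \<otimes>\<^bsub>G\<^esub> c)) P \<cdot> act_mult R b c (M \<odot> P)
    = (M \<triangleleft> act_mult Q b c P) \<cdot> (slide (Th W R b) M (Th W Q b) (\<tau> b) (Th W Q c \<odot> P)
        \<cdot> (Th W R b \<triangleleft> slide (Th W R c) M (Th W Q c) (\<tau> c) P))"
    (is "?L = ?R")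
proof (rule iso_cancel_right)
  note [simp] = half_braiding_simps[OF hb]
  let ?b = "Th W R b" let ?c = "Th W R c" let ?bc = "Th W R (b \<otimes>\<^bsub>G\<^esub> c)"
  let ?b' = "Th W Q b" let ?c' = "Th W Q c" let ?bc' = "Th W Q (b \<otimes>\<^bsub>G\<^esub> c)"
  let ?x = "(?b \<triangleleft> assoc B ?c M P) \<cdot> assoc B ?b (?c \<odot> M) P"
  let ?s = "slide ?b M ?b' (\<tau> b)"
  show "is_iso B ?x" "?x \<in> Ar B" "?L \<in> Ar B" "?R \<in> Ar B" "Dom B ?L = Cod B ?x" "Dom B ?R = Cod B ?x"
    by simp_all
  have nat: "assoc B ?b (M \<odot> ?c') P \<cdot> ((?b \<triangleleft> \<tau> c) \<triangleright> P) = (?b \<triangleleft> (\<tau> c \<triangleright> P)) \<cdot> assoc B ?b (?c \<odot> M) P"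
    by (subst assoc_nat) simp_all
  have "?L \<cdot> ?x = assoc B M ?bc' P \<cdot> ((\<tau> (b \<otimes>\<^bsub>G\<^esub> c) \<cdot> act_mult R b c M) \<triangleright> P)"
    by (simp add: slide_def Cmp_assoc act_mult_rw rw_Cmp)
  also have "\<dots> = (assoc B M ?bc' P \<cdot> ((M \<triangleleft> Mu W Q b c) \<triangleright> P)) \<cdot> ((?s ?c' \<triangleright> P) \<cdot> ((?b \<triangleleft> \<tau> c) \<triangleright> P))"
    by (simp add: half_braiding_Mu[OF hb] Cmp_assoc rw_Cmp)
  also have "\<dots> = (M \<triangleleft> (Mu W Q b c \<triangleright> P)) \<cdot> (assoc B M (?b' \<odot> ?c') P \<cdot> ((?s ?c' \<triangleright> P) \<cdot> ((?b \<triangleleft> \<tau> c) \<triangleright> P)))"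
    by (subst assoc_nat) (simp_all add: Cmp_assoc)
  also have "(?b \<triangleleft> \<tau> c) \<triangleright> P = cinv B (assoc B ?b (M \<odot> ?c') P) \<cdot>
        ((?b \<triangleleft> (\<tau> c \<triangleright> P)) \<cdot> assoc B ?b (?c \<odot> M) P)"
    by (simp add: nat[symmetric])
  also have "(M \<triangleleft> (Mu W Q b c \<triangleright> P)) \<cdot> (assoc B M (?b' \<odot> ?c') P \<cdot> ((?s ?c' \<triangleright> P) \<cdot>
        (cinv B (assoc B ?b (M \<odot> ?c') P) \<cdot> ((?b \<triangleleft> (\<tau> c \<triangleright> P)) \<cdot> assoc B ?b (?c \<odot> M) P))))
     = (M \<triangleleft> (Mu W Q b c \<triangleright> P)) \<cdot> ((assoc B M (?b' \<odot> ?c') P \<cdot> ((?s ?c' \<triangleright> P) \<cdot> cinv B (assoc B ?b (M \<odot> ?c') P))) \<cdot> ((?b \<triangleleft> (\<tau> c \<triangleright> P)) \<cdot> assoc B ?b (?c \<odot> M) P))"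
    by (simp add: Cmp_assoc)
  also have "\<dots> = ?R \<cdot> ?x"
    by (subst slide_rw) (simp_all add: Cmp_assoc act_mult_def lw_Cmp slide_def[of ?c] cinv_lw[symmetric])
  finally show "?L \<cdot> ?x = ?R \<cdot> ?x" .
qed

text \<open>The family that the horizontal composition of twists puts on \<open>M \<odot> N\<close>, read as two moves of
  \<open>\<Theta>(b)\<close>: through \<open>M\<close> with tail \<open>N\<close>, and then through \<open>N\<close>.\<close>
definition comp_braiding where
  "comp_braiding R Q K M \<tau> N \<sigma> b = cinv B (assoc B M N (Th W K b)) \<cdot> ((M \<triangleleft> \<sigma> b) \<cdot>
      slide (Th W R b) M (Th W Q b) (\<tau> b) N)"

lemma comp_braiding_slide:
  assumes hb: "half_braiding R Q M \<tau>" "half_braiding Q K N \<sigma>" and [simp]: "b \<in> carrier G" "P \<in> Ob B" "src B P = K"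
  shows "slide (Th W R b) (M \<odot> N) (Th W K b) (comp_braiding R Q K M \<tau> N \<sigma> b) P
    = cinv B (assoc B M N (Th W K b \<odot> P)) \<cdot> ((M \<triangleleft> slide (Th W Q b) N (Th W K b) (\<sigma> b) P) \<cdot>
       (slide (Th W R b) M (Th W Q b) (\<tau> b) (N \<odot> P) \<cdot> (Th W R b \<triangleleft> assoc B M N P)))"
proof -
  note [simp] = half_braiding_simps[OF hb(1)] half_braiding_simps[OF hb(2)]
  let ?b = "Th W R b" let ?b' = "Th W Q b" let ?b'' = "Th W K b"
  let ?s = "slide ?b M ?b' (\<tau> b)"
  have "slide ?b (M \<odot> N) ?b'' (comp_braiding R Q K M \<tau> N \<sigma> b) P
    = (assoc B (M \<odot> N) ?b'' P \<cdot> (cinv B (assoc B M N ?b'') \<triangleright> P)) \<cdot> (((M \<triangleleft> \<sigma> b) \<triangleright> P) \<cdot> ((?s N \<triangleright> P) \<cdot> cinv B (assoc B ?b (M \<odot> N) P)))"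
    by (simp add: comp_braiding_def slide_def[of _ "M \<odot> N"] rw_Cmp Cmp_assoc)
  also have "\<dots> = cinv B (assoc B M N (?b'' \<odot> P)) \<cdot> ((M \<triangleleft> assoc B N ?b'' P) \<cdot> ((assoc B M (N \<odot> ?b'') P \<cdot>
        ((M \<triangleleft> \<sigma> b) \<triangleright> P)) \<cdot> ((?s N \<triangleright> P) \<cdot> cinv B (assoc B ?b (M \<odot> N) P))))"
    by (subst pentagon_split) (simp_all add: Cmp_assoc)
  also have "assoc B M (N \<odot> ?b'') P \<cdot> ((M \<triangleleft> \<sigma> b) \<triangleright> P) = (M \<triangleleft> (\<sigma> b \<triangleright> P)) \<cdot> assoc B M (?b' \<odot> N) P"
    by (subst assoc_nat) simp_all
  also have "cinv B (assoc B M N (?b'' \<odot> P)) \<cdot> ((M \<triangleleft> assoc B N ?b'' P) \<cdot>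
        (((M \<triangleleft> (\<sigma> b \<triangleright> P)) \<cdot> assoc B M (?b' \<odot> N) P) \<cdot> ((?s N \<triangleright> P) \<cdot> cinv B (assoc B ?b (M \<odot> N) P))))
    = cinv B (assoc B M N (?b'' \<odot> P)) \<cdot> ((M \<triangleleft> assoc B N ?b'' P) \<cdot> ((M \<triangleleft> (\<sigma> b \<triangleright> P)) \<cdot> (assoc B M (?b' \<odot> N) P \<cdot> ((?s N \<triangleright> P) \<cdot> cinv B (assoc B ?b (M \<odot> N) P)))))"
    by (simp add: Cmp_assoc)
  also have "\<dots> = cinv B (assoc B M N (?b'' \<odot> P)) \<cdot> ((M \<triangleleft> slide ?b' N ?b'' (\<sigma> b) P) \<cdot> (?s (N \<odot> P) \<cdot>
        (?b \<triangleleft> assoc B M N P)))"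
    by (subst slide_rw) (simp_all add: Cmp_assoc lw_Cmp slide_def[of ?b'])
  finally show ?thesis .
qed

text \<open>Moving \<open>\<Theta>(c)\<close> and then \<open>\<Theta>(b)\<close> through \<open>M \<odot> N\<close>, and moving both through \<open>M\<close> before moving
  both through \<open>N\<close>, differ in the order of two moves: \<open>\<Theta>(b)\<close> through \<open>M\<close>, and \<open>\<Theta>(c)\<close> through
  \<open>N\<close>. The latter takes place in the tail of the former, so they commute by \<open>slide_nat\<close>.\<close>
lemma half_braiding_comp:
  assumes hb: "half_braiding R Q M \<tau>" "half_braiding Q K N \<sigma>"
  shows "half_braiding R K (M \<odot> N) (comp_braiding R Q K M \<tau> N \<sigma>)"
  unfolding half_braiding_def
proof (intro conjI ballI)
  note [simp] = half_braiding_simps[OF hb(1)] half_braiding_simps[OF hb(2)]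
  show "M \<odot> N \<in> Ob B" "src B (M \<odot> N) = R" "trg B (M \<odot> N) = K" by simp_all
  let ?\<rho> = "comp_braiding R Q K M \<tau> N \<sigma>"
  show "?\<rho> b \<in> isos B (Th W R b \<odot> (M \<odot> N)) ((M \<odot> N) \<odot> Th W K b)" if "b \<in> carrier G" for b
    using that by (simp add: isos_iff comp_braiding_def)
  fix b c assume [simp]: "b \<in> carrier G" "c \<in> carrier G"
  let ?b = "Th W R b" let ?c = "Th W R c"
  let ?b' = "Th W Q b" let ?c' = "Th W Q c"
  let ?b'' = "Th W K b" let ?c'' = "Th W K c" let ?bc = "b \<otimes>\<^bsub>G\<^esub> c"
  let ?sM = "\<lambda>b. slide (Th W R b) M (Th W Q b) (\<tau> b)"
  let ?sN = "\<lambda>b. slide (Th W Q b) N (Th W K b) (\<sigma> b)"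
  let ?i = "\<lambda>P. cinv B (assoc B M N P)"
  have "?\<rho> ?bc \<cdot> act_mult R b c (M \<odot> N)
     = ?i (Th W K ?bc) \<cdot> ((M \<triangleleft> \<sigma> ?bc) \<cdot> (?sM ?bc N \<cdot> act_mult R b c (M \<odot> N)))"
    by (simp add: comp_braiding_def Cmp_assoc)
  also have "\<dots> = ?i (Th W K ?bc) \<cdot> ((M \<triangleleft> (\<sigma> ?bc \<cdot> act_mult Q b c N)) \<cdot> (?sM b (?c' \<odot> N) \<cdot>
        (?b \<triangleleft> ?sM c N)))"
    by (simp add: half_braiding_mult[OF hb(1)] lw_Cmp Cmp_assoc)
  also have "\<dots> = ?i (Th W K ?bc) \<cdot> ((M \<triangleleft> (N \<triangleleft> Mu W K b c)) \<cdot> ((M \<triangleleft> ?sN b ?c'') \<cdot>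
        (((M \<triangleleft> (?b' \<triangleleft> \<sigma> c)) \<cdot> ?sM b (?c' \<odot> N)) \<cdot> (?b \<triangleleft> ?sM c N))))"
    by (simp add: half_braiding_Mu[OF hb(2)] lw_Cmp Cmp_assoc)
  also have "(M \<triangleleft> (?b' \<triangleleft> \<sigma> c)) \<cdot> ?sM b (?c' \<odot> N) = ?sM b (N \<odot> ?c'') \<cdot> (?b \<triangleleft> (M \<triangleleft> \<sigma> c))"
    by (rule slide_nat[symmetric]) simp_all
  also have "?i (Th W K ?bc) \<cdot> ((M \<triangleleft> (N \<triangleleft> Mu W K b c)) \<cdot> ((M \<triangleleft> ?sN b ?c'') \<cdot> ((?sM b (N \<odot> ?c'') \<cdot>
        (?b \<triangleleft> (M \<triangleleft> \<sigma> c))) \<cdot> (?b \<triangleleft> ?sM c N))))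
    = (?i (Th W K ?bc) \<cdot> (M \<triangleleft> (N \<triangleleft> Mu W K b c))) \<cdot> ((M \<triangleleft> ?sN b ?c'') \<cdot> ((?sM b (N \<odot> ?c'') \<cdot> (?b \<triangleleft> (M \<triangleleft> \<sigma> c))) \<cdot> (?b \<triangleleft> ?sM c N)))"
    by (simp add: Cmp_assoc)
  also have "\<dots> = ((M \<odot> N) \<triangleleft> Mu W K b c) \<cdot> (?i (?b'' \<odot> ?c'') \<cdot> ((M \<triangleleft> ?sN b ?c'') \<cdot> (?sM b (N \<odot> ?c'') \<cdot>
        ((?b \<triangleleft> (M \<triangleleft> \<sigma> c)) \<cdot> (?b \<triangleleft> ?sM c N)))))"
    by (subst assoc_inv_nat) (simp_all add: Cmp_assoc)
  also have "\<dots> = ((M \<odot> N) \<triangleleft> Mu W K b c) \<cdot> (slide ?b (M \<odot> N) ?b'' (?\<rho> b) ?c'' \<cdot> (?b \<triangleleft> ?\<rho> c))"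
    by (simp add: comp_braiding_slide[OF hb]) (simp add: comp_braiding_def lw_Cmp Cmp_assoc cinv_lw[symmetric])
  finally show "?\<rho> ?bc \<cdot> act_mult R b c (M \<odot> N)
    = ((M \<odot> N) \<triangleleft> Mu W K b c) \<cdot> (slide ?b (M \<odot> N) ?b'' (?\<rho> b) ?c'' \<cdot> (?b \<triangleleft> ?\<rho> c))" .
qed

text \<open>The multiplicativity law read backwards, as a formula for the inverse of \<open>\<tau> (b c)\<close>, which is the
  direction used in transport maps.\<close>
lemma half_braiding_inv:
  assumes hb: "half_braiding R Q M \<tau>" and [simp]: "b \<in> carrier G" "c \<in> carrier G"
  shows "act_mult R b c M \<cdot> ((Th W R b \<triangleleft> cinv B (\<tau> c)) \<cdot> (assoc B (Th W R b) M (Th W Q c)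
      \<cdot> ((cinv B (\<tau> b) \<triangleright> Th W Q c) \<cdot> (cinv B (assoc B M (Th W Q b) (Th W Q c))
      \<cdot> (M \<triangleleft> cinv B (Mu W Q b c)))))) = cinv B (\<tau> (b \<otimes>\<^bsub>G\<^esub> c))"
proof -
  note [simp] = half_braiding_simps[OF hb]
  have "cinv B (\<tau> (b \<otimes>\<^bsub>G\<^esub> c) \<cdot> act_mult R b c M)
     = cinv B ((M \<triangleleft> Mu W Q b c) \<cdot> (slide (Th W R b) M (Th W Q b) (\<tau> b) (Th W Q c) \<cdot> (Th W R b \<triangleleft> \<tau> c)))"
    by (simp add: half_braiding_Mu[OF hb])
  then have "cinv B (act_mult R b c M) \<cdot> cinv B (\<tau> (b \<otimes>\<^bsub>G\<^esub> c)) 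
    = (Th W R b \<triangleleft> cinv B (\<tau> c)) \<cdot> (assoc B (Th W R b) M (Th W Q c)
      \<cdot> ((cinv B (\<tau> b) \<triangleright> Th W Q c) \<cdot> (cinv B (assoc B M (Th W Q b) (Th W Q c))
      \<cdot> (M \<triangleleft> cinv B (Mu W Q b c)))))"
    by (simp add: cinv_Cmp cinv_lw slide_def cinv_rw Cmp_assoc)
  from this[symmetric] show ?thesis by simp
qed

lemma twist_half_braiding:
  assumes "X \<in> cell1 (twists B G W) R Q"
  shows "half_braiding R Q (fst X) (snd X)"
proof -
  obtain M \<tau> where X: "X = (M, \<tau>)" by (cases X)
  have M: "M \<in> Ob B" "src B M = R" "trg B M = Q"
    and iso: "\<And>b. b \<in> carrier G \<Longrightarrow> \<tau> b \<in> isos B (Th W R b \<odot> M) (M \<odot> Th W Q b)"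
    and mu: "\<And>b c. b \<in> carrier G \<Longrightarrow> c \<in> carrier G \<Longrightarrow> \<tau> (b \<otimes>\<^bsub>G\<^esub> c) =
          (M \<triangleleft> Mu W Q b c) \<cdot> assoc B M (Th W Q b) (Th W Q c) \<cdot> (\<tau> b \<triangleright> (Th W Q c))
          \<cdot> cinv B (assoc B (Th W R b) M (Th W Q c)) \<cdot> (Th W R b \<triangleleft> \<tau> c)
          \<cdot> assoc B (Th W R b) (Th W R c) M \<cdot> (cinv B (Mu W R b c) \<triangleright> M)"
    using assms by (auto simp: cell1_def twists_def tw_cells1_def X Let_def PiE_iff)
  note [simp] = M
  have [simp]: "R \<in> Cells0 B" "Q \<in> Cells0 B" using M src_in[of M] trg_in[of M] by auto
  have [simp]: "\<tau> b \<in> Ar B" "is_iso B (\<tau> b)" "Dom B (\<tau> b) = Th W R b \<odot> M" "Cod B (\<tau> b) = M \<odot> Th W Q b"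
    if "b \<in> carrier G" for b
    using is_iso_of_isos[OF iso[OF that]] by auto
  show ?thesis unfolding half_braiding_def X fst_conv snd_conv
  proof (intro conjI ballI iso)
    fix b c assume [simp]: "b \<in> carrier G" "c \<in> carrier G"
    show "\<tau> (b \<otimes>\<^bsub>G\<^esub> c) \<cdot> act_mult R b c M
        = (M \<triangleleft> Mu W Q b c) \<cdot> (slide (Th W R b) M (Th W Q b) (\<tau> b) (Th W Q c) \<cdot> (Th W R b \<triangleleft> \<tau> c))"
      by (simp add: mu) (simp add: act_mult_def slide_def Cmp_assoc cinv_rw[symmetric])
  qed (simp_all)
qed

end

section \<open>Cyclicity\<close>

context shadowed_bicategory
begin

lemma shA_simps [simp]:
  assumes "f \<in> Ar B" "src B (Dom B f) = trg B (Dom B f)"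
  shows "shA S f \<in> Ar T" "Dom T (shA S f) = shO S (Dom B f)" "Cod T (shA S f) = shO S (Cod B f)"
proof -
  let ?R = "src B (Dom B f)"
  have "?R \<in> Cells0 B" using assms by simp
  note F = shadow_functor[OF this]
  have "f \<in> arrs (hom_cat B ?R ?R) (Dom B f) (Cod B f)"
    using assms by (simp add: arrs_def hom_cat_def cell1_def)
  with F have "shA S f \<in> arrs T (shO S (Dom B f)) (shO S (Cod B f))"
    unfolding is_functor_def by blast
  then show "shA S f \<in> Ar T" "Dom T (shA S f) = shO S (Dom B f)" "Cod T (shA S f) = shO S (Cod B f)"
    by (auto simp: arrs_def)
qed

lemma shO_in [simp]: "M \<in> Ob B \<Longrightarrow> src B M = trg B M \<Longrightarrow> shO S M \<in> Ob T"
  using shadow_functor[of "src B M"] by (auto simp: is_functor_def hom_cat_def cell1_def)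

lemma shA_Idn [simp]: "M \<in> Ob B \<Longrightarrow> src B M = trg B M \<Longrightarrow> shA S (Idn B M) = Idn T (shO S M)"
  using shadow_functor[of "src B M"] by (auto simp: is_functor_def hom_cat_def cell1_def)

lemma shA_Cmp:
  assumes "f \<in> Ar B" "g \<in> Ar B" "Dom B g = Cod B f" "src B (Dom B f) = trg B (Dom B f)"
  shows "shA S (g \<cdot> f) = shA S g \<cdot>\<^bsub>T\<^esub> shA S f"
proof -
  let ?R = "src B (Dom B f)"
  let ?H = "hom_cat B ?R ?R"
  have "?R \<in> Cells0 B" using assms by simp
  note F = shadow_functor[OF this]
  have "f \<in> arrs ?H (Dom B f) (Cod B f)" "g \<in> arrs ?H (Cod B f) (Cod B g)"
    using assms by (simp_all add: arrs_def hom_cat_def cell1_def)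
  with F have "shA S (Cmp ?H g f) = shA S g \<cdot>\<^bsub>T\<^esub> shA S f"
    unfolding is_functor_def by blast
  then show ?thesis by (simp add: hom_cat_def)
qed

lemma is_iso_shA [simp]:
  assumes "is_iso B f" "f \<in> Ar B" "src B (Dom B f) = trg B (Dom B f)"
  shows "is_iso T (shA S f)"
  by (rule T.is_isoI[of _ "shA S (cinv B f)"]) (use assms in \<open>simp_all add: shA_Cmp[symmetric]\<close>)

lemma cinv_shA:
  assumes "is_iso B f" "f \<in> Ar B" "src B (Dom B f) = trg B (Dom B f)"
  shows "cinv T (shA S f) = shA S (cinv B f)"
  by (rule T.cinv_eqI) (use assms in \<open>simp_all add: shA_Cmp[symmetric]\<close>)

lemma theta_simps [simp]:
  assumes "M \<in> Ob B" "N \<in> Ob B" "trg B M = src B N" "trg B N = src B M"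
  shows "theta S M N \<in> Ar T" "Dom T (theta S M N) = shO S (M \<odot> N)"
    "Cod T (theta S M N) = shO S (N \<odot> M)" "is_iso T (theta S M N)"
  using T.is_iso_of_isos[OF theta_iso[of M "src B M" "trg B M" N]] assms by (auto simp: cell1_def)

lemma theta_nat:
  assumes "f \<in> Ar B" "h \<in> Ar B" "trg B (Dom B f) = src B (Dom B h)" "trg B (Dom B h) = src B (Dom B f)"
    "M = Dom B f" "N = Dom B h" "M' = Cod B f" "N' = Cod B h"
  shows "theta S M' N' \<cdot>\<^bsub>T\<^esub> shA S (f \<star> h) = shA S (h \<star> f) \<cdot>\<^bsub>T\<^esub> theta S M N"
  using theta_natural[of M "src B M" "trg B M" N f M' h N'] assms by (simp add: cell1_def arrs_def)

lemma theta_hexagon':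
  assumes "M \<in> Ob B" "N \<in> Ob B" "P \<in> Ob B" "trg B M = src B N" "trg B N = src B P" "trg B P = src B M"
  shows "theta S (M \<odot> N) P = shA S (assoc B P M N) \<cdot>\<^bsub>T\<^esub> (theta S N (P \<odot> M) \<cdot>\<^bsub>T\<^esub> (shA S (assoc B N P M)
           \<cdot>\<^bsub>T\<^esub> (theta S M (N \<odot> P) \<cdot>\<^bsub>T\<^esub> shA S (assoc B M N P))))"
  using theta_hexagon[of M "src B M" "trg B M" N "trg B N" P] assms by (simp add: cell1_def)

text \<open>Apply the hexagon to \<open>M, N, U\<close>. The left side becomes trivial by the
  unit law of the shadow, and on the right the unit can be removed from both instances of \<open>\<theta>\<close> by
  naturality.\<close>
lemma theta_theta:
  assumes [simp]: "M \<in> Ob B" "N \<in> Ob B" "trg B M = src B N" "trg B N = src B M"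
  shows "theta S N M \<cdot>\<^bsub>T\<^esub> theta S M N = Idn T (shO S (M \<odot> N))"
proof (rule T.iso_cancel_right)
  let ?U = "U (src B M)"
  let ?r = "shA S (runit B (M \<odot> N))"
  show "is_iso T ?r" "?r \<in> Ar T" "theta S N M \<cdot>\<^bsub>T\<^esub> theta S M N \<in> Ar T"
    "Idn T (shO S (M \<odot> N)) \<in> Ar T" "Dom T (theta S N M \<cdot>\<^bsub>T\<^esub> theta S M N) = Cod T ?r"
    "Dom T (Idn T (shO S (M \<odot> N))) = Cod T ?r"
    by simp_all
  have "?r = shA S (lunit B (M \<odot> N)) \<cdot>\<^bsub>T\<^esub> theta S (M \<odot> N) ?U"
    using theta_runit[of "M \<odot> N" "src B M"] by (simp add: cell1_def)
  also have "\<dots> = shA S (lunit B (M \<odot> N) \<cdot> assoc B ?U M N) \<cdot>\<^bsub>T\<^esub> (theta S N (?U \<odot> M) \<cdot>\<^bsub>T\<^esub>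
        (shA S (assoc B N ?U M)
           \<cdot>\<^bsub>T\<^esub> (theta S M (N \<odot> ?U) \<cdot>\<^bsub>T\<^esub> shA S (assoc B M N ?U))))"
    by (simp add: theta_hexagon' shA_Cmp T.Cmp_assoc)
  also have "\<dots> = (shA S (lunit B M \<triangleright> N) \<cdot>\<^bsub>T\<^esub> theta S N (?U \<odot> M)) \<cdot>\<^bsub>T\<^esub> (shA S (assoc B N ?U M)
           \<cdot>\<^bsub>T\<^esub> (theta S M (N \<odot> ?U) \<cdot>\<^bsub>T\<^esub> shA S (assoc B M N ?U)))"
    by (simp add: lunit_comp1 T.Cmp_assoc)
  also have "\<dots> = (theta S N M \<cdot>\<^bsub>T\<^esub> shA S (N \<triangleleft> lunit B M)) \<cdot>\<^bsub>T\<^esub> (shA S (assoc B N ?U M)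
           \<cdot>\<^bsub>T\<^esub> (theta S M (N \<odot> ?U) \<cdot>\<^bsub>T\<^esub> shA S (assoc B M N ?U)))"
    by (subst theta_nat[of "Idn B N" "lunit B M", symmetric]) simp_all
  also have "\<dots> = theta S N M \<cdot>\<^bsub>T\<^esub> (shA S ((N \<triangleleft> lunit B M) \<cdot> assoc B N ?U M)
           \<cdot>\<^bsub>T\<^esub> (theta S M (N \<odot> ?U) \<cdot>\<^bsub>T\<^esub> shA S (assoc B M N ?U)))"
    by (simp add: shA_Cmp T.Cmp_assoc)
  also have "\<dots> = theta S N M \<cdot>\<^bsub>T\<^esub> ((shA S (runit B N \<triangleright> M)
           \<cdot>\<^bsub>T\<^esub> theta S M (N \<odot> ?U)) \<cdot>\<^bsub>T\<^esub> shA S (assoc B M N ?U))"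
    by (simp add: triangle' T.Cmp_assoc)
  also have "\<dots> = theta S N M \<cdot>\<^bsub>T\<^esub> ((theta S M N \<cdot>\<^bsub>T\<^esub> shA S (M \<triangleleft> runit B N)) \<cdot>\<^bsub>T\<^esub> shA S (assoc B M N ?U))"
    by (subst theta_nat[of "Idn B M" "runit B N", symmetric]) simp_all
  also have "\<dots> = (theta S N M \<cdot>\<^bsub>T\<^esub> theta S M N) \<cdot>\<^bsub>T\<^esub> shA S ((M \<triangleleft> runit B N) \<cdot> assoc B M N ?U)"
    by (simp add: shA_Cmp T.Cmp_assoc)
  also have "\<dots> = (theta S N M \<cdot>\<^bsub>T\<^esub> theta S M N) \<cdot>\<^bsub>T\<^esub> ?r"
    by (simp add: runit_comp1)
  finally show "(theta S N M \<cdot>\<^bsub>T\<^esub> theta S M N) \<cdot>\<^bsub>T\<^esub> ?r = Idn T (shO S (M \<odot> N)) \<cdot>\<^bsub>T\<^esub> ?r" by simp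
qed

end

section \<open>Twisted cyclicity as a rotation\<close>

locale twisted_shadow = shadowed_bicategory B T S + twisting_data B G W
  for B :: "('o, 'a, 'c, 'z) bicat_scheme" (structure)
    and T :: "('x, 't, 'y) cat_scheme"
    and S :: "('a, 'c, 'x, 't) shadow_data"
    and G :: "('g, 'w) monoid_scheme"
    and W :: "('o, 'g, 'a, 'c) twisting"
begin

definition rotation where
  "rotation X \<tau> b = shA S (cinv B (\<tau> b)) \<cdot>\<^bsub>T\<^esub> theta S (Th W (src B X) b) X"

text \<open>The hexagon for \<open>t, M, N\<close> replaces \<open>\<theta>\<close> at \<open>t \<odot> M, N\<close> by one that moves \<open>t\<close> alone and one that
  moves \<open>M\<close> alone; naturality then puts the transport map between them. In this form the
  leftmost \<open>\<theta>\<close> is inverse to the \<open>\<theta>\<close> with which the second twisted cyclicity begins.\<close>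
lemma tw_theta_eq:
  assumes hM: "half_braiding R Q (fst X) (snd X)" and hN: "half_braiding Q R (fst Y) (snd Y)"
    and [simp]: "g \<in> carrier G"
  defines "M \<equiv> fst X" and "N \<equiv> fst Y" and "t \<equiv> Th W R (inv\<^bsub>G\<^esub> g)" and "t' \<equiv> Th W Q (inv\<^bsub>G\<^esub> g)"
  shows "tw_theta B G W T S g X Y = shA S (assoc B t' N M) \<cdot>\<^bsub>T\<^esub> (theta S M (t' \<odot> N) \<cdot>\<^bsub>T\<^esub>
     shA S ((M \<triangleleft> transport B G g Y) \<cdot> assoc B M N t) \<cdot>\<^bsub>T\<^esub> theta S t (M \<odot> N))"
proof -
  note [simp] = half_braiding_simps[OF hM, folded M_def] half_braiding_simps[OF hN, folded N_def]
  have [simp]: "t \<in> Ob B" "src B t = R" "trg B t = R" "t' \<in> Ob B" "src B t' = Q" "trg B t' = Q"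
    by (simp_all add: t_def t'_def)
  have [simp]: "transport B G g Y \<in> Ar B" "Dom B (transport B G g Y) = N \<odot> t"
     "Cod B (transport B G g Y) = t' \<odot> N"
    by (simp_all add: transport_def t_def t'_def)
  have "tw_theta B G W T S g X Y = shA S (assoc B t' N M) \<cdot>\<^bsub>T\<^esub> (shA S (transport B G g Y \<triangleright> M)
     \<cdot>\<^bsub>T\<^esub> (shA S (cinv B (assoc B N t M)) \<cdot>\<^bsub>T\<^esub> (theta S (t \<odot> M) N \<cdot>\<^bsub>T\<^esub> shA S (cinv B (assoc B t M N)))))"
    by (simp add: tw_theta_def Let_def M_def[symmetric] N_def[symmetric])
      (simp add: t_def t'_def)
  also have "\<dots> = shA S (assoc B t' N M) \<cdot>\<^bsub>T\<^esub> ((shA S (transport B G g Y \<triangleright> M)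
     \<cdot>\<^bsub>T\<^esub> theta S M (N \<odot> t)) \<cdot>\<^bsub>T\<^esub> (shA S (assoc B M N t) \<cdot>\<^bsub>T\<^esub> theta S t (M \<odot> N)))"
    by (simp add: theta_hexagon' T.Cmp_assoc cinv_shA[symmetric])
  also have "\<dots> = shA S (assoc B t' N M) \<cdot>\<^bsub>T\<^esub> ((theta S M (t' \<odot> N)
     \<cdot>\<^bsub>T\<^esub> shA S (M \<triangleleft> transport B G g Y)) \<cdot>\<^bsub>T\<^esub> (shA S (assoc B M N t) \<cdot>\<^bsub>T\<^esub> theta S t (M \<odot> N)))"
    by (subst theta_nat[of "Idn B M" "transport B G g Y", symmetric]) simp_all
  finally show ?thesis by (simp add: shA_Cmp T.Cmp_assoc)
qed

lemma snd_tw_comp1: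
  assumes "src B (fst X) = R" "trg B (fst X) = Q" "trg B (fst Y) = K" "b \<in> carrier G"
  shows "snd (tw_comp1 B G W X Y) b = comp_braiding R Q K (fst X) (snd X) (fst Y) (snd Y) b"
  using assms by (simp add: tw_comp1_def Let_def comp_braiding_def slide_def)

lemma twofold_tw_theta:
  assumes hM: "half_braiding R Q (fst X) (snd X)" and hN: "half_braiding Q R (fst Y) (snd Y)"
    and [simp]: "g \<in> carrier G"
  defines "Z \<equiv> tw_comp1 B G W X Y"
  shows "tw_theta B G W T S g Y X \<cdot>\<^bsub>T\<^esub> tw_theta B G W T S g X Y = rotation (fst Z) (snd Z) (inv\<^bsub>G\<^esub> g)"
proof -
  let ?M = "fst X" let ?N = "fst Y"
  note [simp] = half_braiding_simps[OF hM] half_braiding_simps[OF hN]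
  let ?t = "Th W R (inv\<^bsub>G\<^esub> g)" let ?t' = "Th W Q (inv\<^bsub>G\<^esub> g)"
  let ?gM = "transport B G g X" let ?gN = "transport B G g Y"
  have gs [simp]: "?gM \<in> Ar B" "Dom B ?gM = ?M \<odot> ?t'" "Cod B ?gM = ?t \<odot> ?M"
    "?gN \<in> Ar B" "Dom B ?gN = ?N \<odot> ?t" "Cod B ?gN = ?t' \<odot> ?N"
    by (simp_all add: transport_def)
  have "tw_theta B G W T S g Y X = shA S (assoc B ?t ?M ?N) \<cdot>\<^bsub>T\<^esub> (shA S (?gM \<triangleright> ?N)
     \<cdot>\<^bsub>T\<^esub> (shA S (cinv B (assoc B ?M ?t' ?N)) \<cdot>\<^bsub>T\<^esub> (theta S (?t' \<odot> ?N) ?M \<cdot>\<^bsub>T\<^esub> shA S (cinv B (assoc B ?t' ?N ?M)))))"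
    by (simp add: tw_theta_def Let_def)
  then have "tw_theta B G W T S g Y X \<cdot>\<^bsub>T\<^esub> tw_theta B G W T S g X Y =
     shA S (assoc B ?t ?M ?N) \<cdot>\<^bsub>T\<^esub> (shA S (?gM \<triangleright> ?N) \<cdot>\<^bsub>T\<^esub> (shA S (cinv B (assoc B ?M ?t' ?N)) \<cdot>\<^bsub>T\<^esub>
     ((theta S (?t' \<odot> ?N) ?M \<cdot>\<^bsub>T\<^esub> theta S ?M (?t' \<odot> ?N)) \<cdot>\<^bsub>T\<^esub>
     (shA S ((?M \<triangleleft> ?gN) \<cdot> assoc B ?M ?N ?t) \<cdot>\<^bsub>T\<^esub> theta S ?t (?M \<odot> ?N)))))"
    by (simp add: tw_theta_eq[OF hM hN] T.Cmp_assoc cinv_shA[symmetric])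
  also have "\<dots> = shA S (assoc B ?t ?M ?N \<cdot> ((?gM \<triangleright> ?N) \<cdot> (cinv B (assoc B ?M ?t' ?N) \<cdot>
        ((?M \<triangleleft> ?gN) \<cdot> assoc B ?M ?N ?t)))) \<cdot>\<^bsub>T\<^esub> theta S ?t (?M \<odot> ?N)"
    by (simp add: theta_theta shA_Cmp T.Cmp_assoc)
  also have "assoc B ?t ?M ?N \<cdot> ((?gM \<triangleright> ?N) \<cdot> (cinv B (assoc B ?M ?t' ?N) \<cdot>
        ((?M \<triangleleft> ?gN) \<cdot> assoc B ?M ?N ?t)))
    = cinv B (snd Z (inv\<^bsub>G\<^esub> g))"
    by (simp add: Z_def snd_tw_comp1[where R=R and Q=Q and K=R] comp_braiding_def cinv_Cmp slide_def cinv_lw cinv_rw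
        Cmp_assoc transport_def)
  finally show ?thesis by (simp add: rotation_def Z_def tw_comp1_def Let_def)
qed

end

section \<open>Powers of a rotation\<close>

locale endo_half_braiding = twisted_shadow +
  fixes R X \<tau>
  assumes hb: "half_braiding R R X \<tau>"
begin

declare half_braiding_simps [OF hb, simp]

lemma rotation_simps [simp]:
  assumes "b \<in> carrier G"
  shows "rotation X \<tau> b \<in> Ar T" "Dom T (rotation X \<tau> b) = shO S (Th W R b \<odot> X)"
    "Cod T (rotation X \<tau> b) = shO S (Th W R b \<odot> X)" "is_iso T (rotation X \<tau> b)"
  using assms by (simp_all add: rotation_def)

text \<open>The second half of a partial rotation, when \<open>\<Theta>(b)\<close> has arrived on the right of \<open>\<Theta>(c) \<odot> X\<close>.\<close>
definition absorb where
  "absorb b c = act_mult R c b X \<cdot> ((Th W R c \<triangleleft> cinv B (\<tau> b)) \<cdot> assoc B (Th W R c) X (Th W R b))"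

lemma absorb_simps [simp]:
  assumes "b \<in> carrier G" "c \<in> carrier G"
  shows "absorb b c \<in> Ar B" "is_iso B (absorb b c)" "Dom B (absorb b c) = (Th W R c \<odot> X) \<odot> Th W R b"
    "Cod B (absorb b c) = Th W R (c \<otimes>\<^bsub>G\<^esub> b) \<odot> X"
  using assms by (simp_all add: absorb_def)

text \<open>The part inside \<open>\<Theta>(c) \<odot> _\<close> is the multiplicativity of \<open>\<tau>\<close>; the rest is the associativity
  of the action and its compatibility with right whiskering.\<close>
lemma absorb_Mu:
  assumes [simp]: "b \<in> carrier G" "d \<in> carrier G" "c \<in> carrier G"
  shows "absorb (b \<otimes>\<^bsub>G\<^esub> d) c \<cdot> ((Th W R c \<odot> X) \<triangleleft> Mu W R b d)
    = absorb d (c \<otimes>\<^bsub>G\<^esub> b) \<cdot> ((absorb b c \<triangleright> Th W R d) \<cdot> cinv B (assoc B (Th W R c \<odot> X) (Th W R b) (Th W R d)))"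
proof -
  let ?b = "Th W R b" let ?c = "Th W R c" let ?d = "Th W R d"
  let ?s = "\<lambda>b. cinv B (\<tau> b)"
  let ?w = "act_mult R b d X \<cdot> ((?b \<triangleleft> ?s d) \<cdot> (assoc B ?b X ?d \<cdot>
        ((?s b \<triangleright> ?d) \<cdot> cinv B (assoc B X ?b ?d))))"
  have w: "?s (b \<otimes>\<^bsub>G\<^esub> d) \<cdot> (X \<triangleleft> Mu W R b d) = ?w"
  proof -
    have "?s (b \<otimes>\<^bsub>G\<^esub> d) = ?w \<cdot> cinv B (X \<triangleleft> Mu W R b d)"
      by (simp add: half_braiding_inv[OF hb, symmetric] Cmp_assoc cinv_lw)
    then show ?thesis by (simp add: Cmp_assoc)
  qed
  have "absorb (b \<otimes>\<^bsub>G\<^esub> d) c \<cdot> ((?c \<odot> X) \<triangleleft> Mu W R b d)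
    = act_mult R c (b \<otimes>\<^bsub>G\<^esub> d) X \<cdot> ((?c \<triangleleft> ?s (b \<otimes>\<^bsub>G\<^esub> d)) \<cdot> (assoc B ?c X (Th W R (b \<otimes>\<^bsub>G\<^esub> d)) \<cdot> ((Idn B ?c \<star> Idn B X) \<star> Mu W R b d)))"
    by (simp add: absorb_def Cmp_assoc)
  also have "\<dots> = act_mult R c (b \<otimes>\<^bsub>G\<^esub> d) X \<cdot> ((?c \<triangleleft> (?s (b \<otimes>\<^bsub>G\<^esub> d) \<cdot>
        (X \<triangleleft> Mu W R b d))) \<cdot> assoc B ?c X (?b \<odot> ?d))"
    by (subst assoc_nat) (simp_all add: Cmp_assoc lw_Cmp)
  also have "\<dots> = act_mult R c (b \<otimes>\<^bsub>G\<^esub> d) X \<cdot> ((?c \<triangleleft> ?w) \<cdot> assoc B ?c X (?b \<odot> ?d))"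
    by (simp only: w)
  also have "\<dots> = (act_mult R c (b \<otimes>\<^bsub>G\<^esub> d) X \<cdot> (?c \<triangleleft> act_mult R b d X)) \<cdot> ((?c \<triangleleft> (?b \<triangleleft> ?s d)) \<cdot>
        ((?c \<triangleleft> assoc B ?b X ?d) \<cdot>
       ((?c \<triangleleft> (?s b \<triangleright> ?d)) \<cdot> ((?c \<triangleleft> cinv B (assoc B X ?b ?d)) \<cdot> assoc B ?c X (?b \<odot> ?d)))))"
    by (simp add: lw_Cmp Cmp_assoc)
  also have "\<dots> = act_mult R (c \<otimes>\<^bsub>G\<^esub> b) d X \<cdot> ((act_mult R c b (?d \<odot> X) \<cdot> (?c \<triangleleft> (?b \<triangleleft> ?s d))) \<cdot>
        ((?c \<triangleleft> assoc B ?b X ?d) \<cdot>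
       ((?c \<triangleleft> (?s b \<triangleright> ?d)) \<cdot> (assoc B ?c (X \<odot> ?b) ?d \<cdot> ((assoc B ?c X ?b \<triangleright> ?d) \<cdot> cinv B (assoc B (?c \<odot> X) ?b ?d))))))"
    by (simp add: act_mult_assoc[symmetric] pentagon_mixed Cmp_assoc G.m_assoc)
  also have "\<dots> = act_mult R (c \<otimes>\<^bsub>G\<^esub> b) d X \<cdot> ((Th W R (c \<otimes>\<^bsub>G\<^esub> b) \<triangleleft> ?s d) \<cdot> (act_mult R c b (X \<odot> ?d) \<cdot>
        ((?c \<triangleleft> assoc B ?b X ?d) \<cdot>
       (((?c \<triangleleft> (?s b \<triangleright> ?d)) \<cdot> assoc B ?c (X \<odot> ?b) ?d) \<cdot> ((assoc B ?c X ?b \<triangleright> ?d) \<cdot> cinv B (assoc B (?c \<odot> X) ?b ?d))))))"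
    by (subst act_mult_nat[where P = "X \<odot> ?d"]) (simp_all add: Cmp_assoc)
  also have "(?c \<triangleleft> (?s b \<triangleright> ?d)) \<cdot> assoc B ?c (X \<odot> ?b) ?d = assoc B ?c (?b \<odot> X) ?d \<cdot> ((?c \<triangleleft> ?s b) \<triangleright> ?d)"
    by (subst assoc_nat) simp_all
  also have "act_mult R (c \<otimes>\<^bsub>G\<^esub> b) d X \<cdot> ((Th W R (c \<otimes>\<^bsub>G\<^esub> b) \<triangleleft> ?s d) \<cdot> (act_mult R c b (X \<odot> ?d) \<cdot>
        ((?c \<triangleleft> assoc B ?b X ?d) \<cdot>
       ((assoc B ?c (?b \<odot> X) ?d \<cdot> ((?c \<triangleleft> ?s b) \<triangleright> ?d)) \<cdot> ((assoc B ?c X ?b \<triangleright> ?d) \<cdot> cinv B (assoc B (?c \<odot> X) ?b ?d))))))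
    = act_mult R (c \<otimes>\<^bsub>G\<^esub> b) d X \<cdot> ((Th W R (c \<otimes>\<^bsub>G\<^esub> b) \<triangleleft> ?s d) \<cdot> ((act_mult R c b (X \<odot> ?d) \<cdot> ((?c \<triangleleft> assoc B ?b X ?d) \<cdot>
       assoc B ?c (?b \<odot> X) ?d)) \<cdot> (((?c \<triangleleft> ?s b) \<triangleright> ?d) \<cdot> ((assoc B ?c X ?b \<triangleright> ?d) \<cdot> cinv B (assoc B (?c \<odot> X) ?b ?d)))))"
    by (simp add: Cmp_assoc)
  also have "\<dots> = absorb d (c \<otimes>\<^bsub>G\<^esub> b) \<cdot> ((absorb b c \<triangleright> ?d) \<cdot> cinv B (assoc B (?c \<odot> X) ?b ?d))"
    by (subst act_mult_rw) (simp_all add: absorb_def rw_Cmp Cmp_assoc)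
  finally show ?thesis .
qed

text \<open>Either way \<open>\<Theta>(b)\<close> passes through \<open>X\<close> and the factors \<open>\<Theta>(d)\<close>, \<open>\<Theta>(c)\<close>, \<open>\<Theta>(b)\<close> are multiplied; the two
  orders of multiplying agree by associativity of the action.\<close>
lemma absorb_act_mult:
  assumes [simp]: "b \<in> carrier G" "d \<in> carrier G" "c \<in> carrier G"
  shows "act_mult R d (c \<otimes>\<^bsub>G\<^esub> b) X \<cdot>
        ((Th W R d \<triangleleft> absorb b c) \<cdot> assoc B (Th W R d) (Th W R c \<odot> X) (Th W R b))
    = absorb b (d \<otimes>\<^bsub>G\<^esub> c) \<cdot> (act_mult R d c X \<triangleright> Th W R b)"
proof -
  let ?b = "Th W R b" let ?c = "Th W R c" let ?d = "Th W R d"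
  let ?s = "\<lambda>b. cinv B (\<tau> b)"
  have "act_mult R d (c \<otimes>\<^bsub>G\<^esub> b) X \<cdot> ((?d \<triangleleft> absorb b c) \<cdot> assoc B ?d (?c \<odot> X) ?b)
    = (act_mult R d (c \<otimes>\<^bsub>G\<^esub> b) X \<cdot> (?d \<triangleleft> act_mult R c b X)) \<cdot> ((?d \<triangleleft> (?c \<triangleleft> ?s b)) \<cdot> ((?d \<triangleleft> assoc B ?c X ?b) \<cdot> assoc B ?d (?c \<odot> X) ?b))"
    by (simp add: absorb_def lw_Cmp Cmp_assoc)
  also have "\<dots> = act_mult R (d \<otimes>\<^bsub>G\<^esub> c) b X \<cdot> ((act_mult R d c (?b \<odot> X) \<cdot> (?d \<triangleleft> (?c \<triangleleft> ?s b))) \<cdot>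
        ((?d \<triangleleft> assoc B ?c X ?b) \<cdot> assoc B ?d (?c \<odot> X) ?b))"
    by (simp add: act_mult_assoc[symmetric] Cmp_assoc G.m_assoc)
  also have "\<dots> = act_mult R (d \<otimes>\<^bsub>G\<^esub> c) b X \<cdot> ((Th W R (d \<otimes>\<^bsub>G\<^esub> c) \<triangleleft> ?s b) \<cdot> (act_mult R d c (X \<odot> ?b) \<cdot>
        ((?d \<triangleleft> assoc B ?c X ?b) \<cdot> assoc B ?d (?c \<odot> X) ?b)))"
    by (subst act_mult_nat[where P = "X \<odot> ?b"]) (simp_all add: Cmp_assoc)
  finally show ?thesis by (simp add: act_mult_rw absorb_def Cmp_assoc)
qed

definition partial_rotation where
  "partial_rotation b c = shA S (absorb b c) \<cdot>\<^bsub>T\<^esub>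
        (theta S (Th W R b) (Th W R c \<odot> X) \<cdot>\<^bsub>T\<^esub> shA S (cinv B (act_mult R b c X)))"

lemma partial_rotation_simps [simp]:
  assumes "b \<in> carrier G" "c \<in> carrier G"
  shows "partial_rotation b c \<in> Ar T" "is_iso T (partial_rotation b c)"
    "Dom T (partial_rotation b c) = shO S (Th W R (b \<otimes>\<^bsub>G\<^esub> c) \<odot> X)"
    "Cod T (partial_rotation b c) = shO S (Th W R (c \<otimes>\<^bsub>G\<^esub> b) \<odot> X)"
  using assms by (simp_all add: partial_rotation_def)

text \<open>In the composite of two partial rotations,
  \<open>\<Theta>(b)\<close> is absorbed before \<open>\<Theta>(d)\<close> leaves. By naturality this absorption can be
  postponed (\<open>absorb_act_mult\<close>), which makes the two cyclicities adjacent; the hexagon joins them and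
  \<open>absorb_Mu\<close> joins the two absorptions.\<close>
lemma partial_rotation_mult:
  assumes [simp]: "b \<in> carrier G" "d \<in> carrier G" "c \<in> carrier G"
  shows "partial_rotation (b \<otimes>\<^bsub>G\<^esub> d) c = partial_rotation d (c \<otimes>\<^bsub>G\<^esub> b) \<cdot>\<^bsub>T\<^esub> partial_rotation b (d \<otimes>\<^bsub>G\<^esub> c)"
proof -
  let ?b = "Th W R b" let ?c = "Th W R c" let ?d = "Th W R d"
  let ?bd = "Th W R (b \<otimes>\<^bsub>G\<^esub> d)"
  let ?Y = "?c \<odot> X"
  have 1: "theta S ?b (Th W R (d \<otimes>\<^bsub>G\<^esub> c) \<odot> X) = shA S (act_mult R d c X \<triangleright> ?b) \<cdot>\<^bsub>T\<^esub>
        (theta S ?b (?d \<odot> ?Y) \<cdot>\<^bsub>T\<^esub> shA S (?b \<triangleleft> cinv B (act_mult R d c X)))"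
    by (subst theta_nat[of "Idn B ?b" "cinv B (act_mult R d c X)" ?b "Th W R (d \<otimes>\<^bsub>G\<^esub> c) \<odot> X"])
      (simp_all add: cinv_rw[symmetric] cinv_shA[symmetric])
  have 2: "(?b \<triangleleft> cinv B (act_mult R d c X)) \<cdot> cinv B (act_mult R b (d \<otimes>\<^bsub>G\<^esub> c) X)
      = assoc B ?b ?d ?Y \<cdot> (cinv B (Mu W R b d \<triangleright> ?Y) \<cdot> cinv B (act_mult R (b \<otimes>\<^bsub>G\<^esub> d) c X))"
  proof -
    have "cinv B (act_mult R b (d \<otimes>\<^bsub>G\<^esub> c) X \<cdot>
          (?b \<triangleleft> act_mult R d c X)) = cinv B (act_mult R (b \<otimes>\<^bsub>G\<^esub> d) c X \<cdot> act_mult R b d ?Y)"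
      by (simp add: act_mult_assoc)
    then show ?thesis by (simp add: cinv_Cmp cinv_lw act_mult_def[of _ _ _ ?Y] Cmp_assoc G.m_assoc)
  qed
  have 3: "theta S ?d (?Y \<odot> ?b) \<cdot>\<^bsub>T\<^esub> (shA S (assoc B ?d ?Y ?b) \<cdot>\<^bsub>T\<^esub>
        (theta S ?b (?d \<odot> ?Y) \<cdot>\<^bsub>T\<^esub> shA S (assoc B ?b ?d ?Y)))
     = shA S (cinv B (assoc B ?Y ?b ?d)) \<cdot>\<^bsub>T\<^esub> theta S (?b \<odot> ?d) ?Y"
    by (simp add: theta_hexagon' cinv_shA[symmetric])
  \<comment> \<open>The hexagon produces this composite of two absorptions, which follows \<open>\<theta>\<close>.\<close>
  have 4: "absorb d (c \<otimes>\<^bsub>G\<^esub> b) \<cdot> ((absorb b c \<triangleright> ?d) \<cdot> cinv B (assoc B ?Y ?b ?d)) \<cdot>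
        (?Y \<triangleleft> cinv B (Mu W R b d))
     = absorb (b \<otimes>\<^bsub>G\<^esub> d) c"
  proof -
    have "(absorb d (c \<otimes>\<^bsub>G\<^esub> b) \<cdot> ((absorb b c \<triangleright> ?d) \<cdot> cinv B (assoc B ?Y ?b ?d))) \<cdot>
          (?Y \<triangleleft> cinv B (Mu W R b d))
      = (absorb (b \<otimes>\<^bsub>G\<^esub> d) c \<cdot> (?Y \<triangleleft> Mu W R b d)) \<cdot> cinv B (?Y \<triangleleft> Mu W R b d)"
      by (simp add: absorb_Mu cinv_lw)
    then show ?thesis by (simp add: Cmp_assoc G.m_assoc)
  qed
  have "partial_rotation d (c \<otimes>\<^bsub>G\<^esub> b) \<cdot>\<^bsub>T\<^esub> partial_rotation b (d \<otimes>\<^bsub>G\<^esub> c)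
    = shA S (absorb d (c \<otimes>\<^bsub>G\<^esub> b)) \<cdot>\<^bsub>T\<^esub> (theta S ?d (Th W R (c \<otimes>\<^bsub>G\<^esub> b) \<odot> X) \<cdot>\<^bsub>T\<^esub> (shA S (cinv B (act_mult R d (c \<otimes>\<^bsub>G\<^esub> b) X) \<cdot> (absorb b (d \<otimes>\<^bsub>G\<^esub> c) \<cdot> (act_mult R d c X \<triangleright> ?b)))
       \<cdot>\<^bsub>T\<^esub> (theta S ?b (?d \<odot> ?Y) \<cdot>\<^bsub>T\<^esub> shA S ((?b \<triangleleft> cinv B (act_mult R d c X)) \<cdot> cinv B (act_mult R b (d \<otimes>\<^bsub>G\<^esub> c) X)))))"
    by (simp add: partial_rotation_def 1 T.Cmp_assoc shA_Cmp G.m_assoc)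
  also have "\<dots> = shA S (absorb d (c \<otimes>\<^bsub>G\<^esub> b)) \<cdot>\<^bsub>T\<^esub>
        ((theta S ?d (Th W R (c \<otimes>\<^bsub>G\<^esub> b) \<odot> X) \<cdot>\<^bsub>T\<^esub> shA S (?d \<triangleleft> absorb b c)) \<cdot>\<^bsub>T\<^esub> (shA S (assoc B ?d ?Y ?b)
       \<cdot>\<^bsub>T\<^esub> (theta S ?b (?d \<odot> ?Y) \<cdot>\<^bsub>T\<^esub> shA S ((?b \<triangleleft> cinv B (act_mult R d c X)) \<cdot> cinv B (act_mult R b (d \<otimes>\<^bsub>G\<^esub> c) X)))))"
    by (simp add: absorb_act_mult[symmetric] T.Cmp_assoc shA_Cmp G.m_assoc)
  also have "\<dots> = shA S (absorb d (c \<otimes>\<^bsub>G\<^esub> b)) \<cdot>\<^bsub>T\<^esub>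
        ((shA S (absorb b c \<triangleright> ?d) \<cdot>\<^bsub>T\<^esub> theta S ?d (?Y \<odot> ?b)) \<cdot>\<^bsub>T\<^esub> (shA S (assoc B ?d ?Y ?b)
       \<cdot>\<^bsub>T\<^esub> (theta S ?b (?d \<odot> ?Y) \<cdot>\<^bsub>T\<^esub> shA S ((?b \<triangleleft> cinv B (act_mult R d c X)) \<cdot> cinv B (act_mult R b (d \<otimes>\<^bsub>G\<^esub> c) X)))))"
    by (subst theta_nat[of "Idn B ?d" "absorb b c"]) simp_all
  also have "\<dots> = shA S (absorb d (c \<otimes>\<^bsub>G\<^esub> b)) \<cdot>\<^bsub>T\<^esub> (shA S (absorb b c \<triangleright> ?d) \<cdot>\<^bsub>T\<^esub>
        ((theta S ?d (?Y \<odot> ?b) \<cdot>\<^bsub>T\<^esub> (shA S (assoc B ?d ?Y ?b)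
       \<cdot>\<^bsub>T\<^esub> (theta S ?b (?d \<odot> ?Y) \<cdot>\<^bsub>T\<^esub> shA S (assoc B ?b ?d ?Y)))) \<cdot>\<^bsub>T\<^esub> shA S (cinv B (Mu W R b d \<triangleright> ?Y) \<cdot> cinv B (act_mult R (b \<otimes>\<^bsub>G\<^esub> d) c X))))"
    by (simp add: 2 shA_Cmp T.Cmp_assoc G.m_assoc)
  also have "\<dots> = shA S (absorb d (c \<otimes>\<^bsub>G\<^esub> b) \<cdot> ((absorb b c \<triangleright> ?d) \<cdot> cinv B (assoc B ?Y ?b ?d))) \<cdot>\<^bsub>T\<^esub>
        ((theta S (?b \<odot> ?d) ?Y \<cdot>\<^bsub>T\<^esub> shA S (cinv B (Mu W R b d) \<triangleright> ?Y)) \<cdot>\<^bsub>T\<^esub> shA S (cinv B (act_mult R (b \<otimes>\<^bsub>G\<^esub> d) c X)))"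
    by (subst 3) (simp add: shA_Cmp T.Cmp_assoc cinv_rw)
  also have "\<dots> = shA S (absorb d (c \<otimes>\<^bsub>G\<^esub> b) \<cdot> ((absorb b c \<triangleright> ?d) \<cdot> cinv B (assoc B ?Y ?b ?d))) \<cdot>\<^bsub>T\<^esub>
        ((shA S (?Y \<triangleleft> cinv B (Mu W R b d)) \<cdot>\<^bsub>T\<^esub> theta S ?bd ?Y) \<cdot>\<^bsub>T\<^esub> shA S (cinv B (act_mult R (b \<otimes>\<^bsub>G\<^esub> d) c X)))"
    by (subst theta_nat[of "cinv B (Mu W R b d)" "Idn B ?Y"]) simp_all
  also have "\<dots> = partial_rotation (b \<otimes>\<^bsub>G\<^esub> d) c"
    by (simp add: partial_rotation_def 4[symmetric] shA_Cmp T.Cmp_assoc)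
  finally show ?thesis by simp
qed

text \<open>By \<open>partial_rotation_mult\<close> for \<open>1 = 1 1\<close> this isomorphism is idempotent, and an
  idempotent isomorphism is an identity.\<close>
lemma partial_rotation_one:
  assumes [simp]: "c \<in> carrier G"
  shows "partial_rotation \<one>\<^bsub>G\<^esub> c = Idn T (shO S (Th W R c \<odot> X))"
proof -
  have "partial_rotation \<one>\<^bsub>G\<^esub> c \<cdot>\<^bsub>T\<^esub> partial_rotation \<one>\<^bsub>G\<^esub> c = partial_rotation \<one>\<^bsub>G\<^esub> c \<cdot>\<^bsub>T\<^esub> Idn T (shO S (Th W R c \<odot> X))"
    using partial_rotation_mult[of "\<one>\<^bsub>G\<^esub>" "\<one>\<^bsub>G\<^esub>" c] by simp
  then show ?thesis by (rule T.iso_cancel_left[rotated -1]) simp_all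
qed

lemma absorb_unit:
  assumes [simp]: "b \<in> carrier G"
  shows "absorb b \<one>\<^bsub>G\<^esub> \<cdot> (act_unit R X \<triangleright> Th W R b) = cinv B (\<tau> b)"
proof -
  let ?b = "Th W R b" let ?e = "Th W R \<one>\<^bsub>G\<^esub>" let ?u = "act_unit R"
  let ?s = "cinv B (\<tau> b)"
  have "absorb b \<one>\<^bsub>G\<^esub> \<cdot> (?u X \<triangleright> ?b) = act_mult R \<one>\<^bsub>G\<^esub> b X \<cdot> ((?e \<triangleleft> ?s) \<cdot> ?u (X \<odot> ?b))"
    by (simp add: absorb_def act_unit_rw Cmp_assoc)
  also have "\<dots> = (act_mult R \<one>\<^bsub>G\<^esub> b X \<cdot> ?u (?b \<odot> X)) \<cdot> ?s"
    by (simp add: act_unit_nat[of R ?s "X \<odot> ?b" "?b \<odot> X", symmetric] Cmp_assoc)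
  also have "\<dots> = ?s"
    by (simp add: act_mult_unit_left)
  finally show ?thesis .
qed

lemma rotation_eq_orbit_rotation:
  assumes [simp]: "b \<in> carrier G"
  shows "partial_rotation b \<one>\<^bsub>G\<^esub> = rotation X \<tau> b"
proof -
  let ?b = "Th W R b" let ?e = "Th W R \<one>\<^bsub>G\<^esub>" let ?u = "act_unit R"
  let ?s = "cinv B (\<tau> b)"
  have 1: "cinv B (act_mult R b \<one>\<^bsub>G\<^esub> X) = ?b \<triangleleft> ?u X"
    by (rule cinv_eq_right_inverse) (simp_all add: act_mult_unit_right)
  have "partial_rotation b \<one>\<^bsub>G\<^esub> = shA S (absorb b \<one>\<^bsub>G\<^esub>) \<cdot>\<^bsub>T\<^esub>
        (theta S ?b (?e \<odot> X) \<cdot>\<^bsub>T\<^esub> shA S (?b \<triangleleft> ?u X))"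
    by (simp add: partial_rotation_def 1)
  also have "\<dots> = shA S (absorb b \<one>\<^bsub>G\<^esub>) \<cdot>\<^bsub>T\<^esub> (shA S (?u X \<triangleright> ?b) \<cdot>\<^bsub>T\<^esub> theta S ?b X)"
    by (subst theta_nat[of "Idn B ?b" "?u X"]) simp_all
  also have "\<dots> = shA S (absorb b \<one>\<^bsub>G\<^esub> \<cdot> (?u X \<triangleright> ?b)) \<cdot>\<^bsub>T\<^esub> theta S ?b X"
    by (simp add: shA_Cmp T.Cmp_assoc)
  finally show ?thesis by (simp add: absorb_unit rotation_def)
qed

text \<open>The second argument makes the product \<open>b\<^sup>n b\<^sup>1\<^sup>-\<^sup>n = b\<close> independent of \<open>n\<close>, so that all these
  partial rotations act on the same shadow and one more factor is split off at each step.\<close>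
lemma rotation_power:
  assumes [simp]: "b \<in> carrier G"
  shows "cpow T (rotation X \<tau> b) n = partial_rotation (b [^]\<^bsub>G\<^esub> int n) (b [^]\<^bsub>G\<^esub> (1 - int n))"
proof (induction n)
  case 0
  show ?case by (simp add: partial_rotation_one)
next
  case (Suc n)
  let ?c = "b [^]\<^bsub>G\<^esub> (1 - int (Suc n))"
  have b: "b = b [^]\<^bsub>G\<^esub> (1::int)" by simp
  have "b [^]\<^bsub>G\<^esub> int (Suc n) = b [^]\<^bsub>G\<^esub> int n \<otimes>\<^bsub>G\<^esub> b"
    using G.int_pow_mult[of b "int n" 1] by (simp add: add.commute)
  moreover have "b \<otimes>\<^bsub>G\<^esub> ?c = b [^]\<^bsub>G\<^esub> (1 - int n)"
    using G.int_pow_mult[of b 1 "1 - int (Suc n)"] by simp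
  moreover have "?c \<otimes>\<^bsub>G\<^esub> b [^]\<^bsub>G\<^esub> int n = \<one>\<^bsub>G\<^esub>"
    using G.int_pow_mult[of b "1 - int (Suc n)" "int n"] by simp
  ultimately have "partial_rotation (b [^]\<^bsub>G\<^esub> int (Suc n)) ?c
     = partial_rotation b \<one>\<^bsub>G\<^esub> \<cdot>\<^bsub>T\<^esub> partial_rotation (b [^]\<^bsub>G\<^esub> int n) (b [^]\<^bsub>G\<^esub> (1 - int n))"
    using partial_rotation_mult[of "b [^]\<^bsub>G\<^esub> int n" b ?c] by simp
  then show ?case by (simp add: Suc.IH rotation_eq_orbit_rotation)
qed

lemma rotation_power_one:
  assumes [simp]: "b \<in> carrier G" and "b [^]\<^bsub>G\<^esub> (n::nat) = \<one>\<^bsub>G\<^esub>"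
  shows "cpow T (rotation X \<tau> b) n = Idn T (shO S (Th W R b \<odot> X))"
proof -
  have 1: "b [^]\<^bsub>G\<^esub> int n = \<one>\<^bsub>G\<^esub>" using assms by (simp add: int_pow_int)
  then have "b [^]\<^bsub>G\<^esub> (1 - int n) = b"
    using G.int_pow_mult[of b "1 - int n" "int n"] by simp
  then show ?thesis by (simp add: rotation_power 1 partial_rotation_one)
qed

section \<open>Conjugation transport as a rotation\<close>

text \<open>In the names of the proof, \<open>t\<close> occurs twice: as the twist \<open>\<Theta>(g\<^sup>-\<^sup>1)\<close> and as a member of the
  inserted pair \<open>t \<odot> s\<close>. The hexagon for \<open>t \<odot> X, t, s\<close> and the unit law of the shadow turn insertion on
  the right into insertion on the left, followed by a \<open>\<theta>\<close> that moves the inserted \<open>t\<close> alone (\<open>hex\<close>). Contracting \<open>s\<close> with the original \<open>t\<close> (\<open>\<kappa>\<close>) commutes with the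
  transport (\<open>slip\<close>), and by naturality can be carried out before \<open>\<theta>\<close>, where it cancels the
  insertion by a triangle identity (\<open>zigzag\<close>).\<close>
lemma conj_transport_eq_rotation:
  assumes [simp]: "g \<in> carrier G" and X: "fst Z = X" "snd Z = \<tau>"
  shows "conj_transport B G W T S g g Z = rotation X \<tau> (inv\<^bsub>G\<^esub> g)"
proof -
  let ?h = "inv\<^bsub>G\<^esub> g"
  let ?t = "Th W R ?h" let ?s = "Th W R g" let ?e = "Th W R \<one>\<^bsub>G\<^esub>"
  let ?u = "act_unit R"
  let ?\<sigma> = "cinv B (\<tau> ?h)"
  let ?Y = "?t \<odot> X"
  let ?coev = "cinv B (Mu W R ?h g) \<cdot> Eta W R"
  let ?\<kappa> = "cinv B (?u X) \<cdot> act_mult R g ?h X"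
  let ?m = "(Mu W R \<one>\<^bsub>G\<^esub> ?h \<cdot> (Mu W R g ?h \<triangleright> ?t)) \<triangleright> X"
  let ?m' = "cinv B (assoc B (?s \<odot> ?t) ?t X) \<cdot> cinv B (assoc B ?s ?t (?t \<odot> X))"
  have zigzag: "(?t \<triangleleft> ?\<kappa>) \<cdot> (assoc B ?t ?s ?Y \<cdot> ((?coev \<triangleright> ?Y) \<cdot> cinv B (lunit B ?Y))) = Idn B ?Y"
  proof -
    have unitors: "cinv B (act_mult R \<one>\<^bsub>G\<^esub> ?h X) = ?u ?Y" "cinv B (act_mult R ?h \<one>\<^bsub>G\<^esub> X) = ?t \<triangleleft> ?u X"
      by (rule cinv_eq_right_inverse; simp add: act_mult_unit_left act_mult_unit_right)+
    have "(?t \<triangleleft> act_mult R g ?h X) \<cdot> cinv B (act_mult R ?h g ?Y)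
      = cinv B (act_mult R ?h \<one>\<^bsub>G\<^esub> X) \<cdot> act_mult R \<one>\<^bsub>G\<^esub> ?h X"
      by (rule cinv_swap) (use act_mult_assoc[of R ?h g ?h X] in simp_all)
    then have swap: "(?t \<triangleleft> act_mult R g ?h X) \<cdot> (cinv B (act_mult R ?h g ?Y) \<cdot> ?u ?Y) = ?t \<triangleleft> ?u X"
      by (subst Cmp_assoc[symmetric]) (simp_all add: Cmp_assoc unitors act_mult_unit_left)
    have "assoc B ?t ?s ?Y \<cdot> ((?coev \<triangleright> ?Y) \<cdot> cinv B (lunit B ?Y)) = cinv B (act_mult R ?h g ?Y) \<cdot> ?u ?Y"
      by (simp add: act_mult_def act_unit_def cinv_Cmp cinv_rw rw_Cmp Cmp_assoc)
    then show ?thesis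
      by (simp add: lw_Cmp Cmp_assoc swap cinv_lw[symmetric])
  qed
  have slip: "?m \<cdot> (?m' \<cdot> ((?s \<triangleleft> (?t \<triangleleft> ?\<sigma>)) \<cdot> ((?s \<triangleleft> assoc B ?t X ?t) \<cdot> assoc B ?s ?Y ?t))) = ?\<sigma> \<cdot>
        (?\<kappa> \<triangleright> ?t)"
  proof -
    have "?m \<cdot> (?m' \<cdot> ((?s \<triangleleft> (?t \<triangleleft> ?\<sigma>)) \<cdot> ((?s \<triangleleft> assoc B ?t X ?t) \<cdot> assoc B ?s ?Y ?t)))
      = act_mult R \<one>\<^bsub>G\<^esub> ?h X \<cdot> ((act_mult R g ?h (?t \<odot> X) \<cdot> (?s \<triangleleft> (?t \<triangleleft> ?\<sigma>))) \<cdot> ((?s \<triangleleft> assoc B ?t X ?t) \<cdot> assoc B ?s ?Y ?t))"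
    proof -
      have nat: "((Mu W R g ?h \<triangleright> ?t) \<triangleright> X) \<cdot> cinv B (assoc B (?s \<odot> ?t) ?t X) = cinv B (assoc B ?e ?t X) \<cdot>
            (Mu W R g ?h \<triangleright> ?Y)"
        using assoc_inv_nat[of "Mu W R g ?h" "Idn B ?t" "Idn B X" ?e ?t X] by simp
      have "?m \<cdot> ?m' = (Mu W R \<one>\<^bsub>G\<^esub> ?h \<triangleright> X) \<cdot>
            ((((Mu W R g ?h \<triangleright> ?t) \<triangleright> X) \<cdot> cinv B (assoc B (?s \<odot> ?t) ?t X)) \<cdot> cinv B (assoc B ?s ?t ?Y))"
        by (simp add: rw_Cmp Cmp_assoc)
      also have "\<dots> = act_mult R \<one>\<^bsub>G\<^esub> ?h X \<cdot> act_mult R g ?h ?Y"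
        by (subst nat) (simp add: act_mult_def Cmp_assoc)
      finally have eq: "?m \<cdot> ?m' = act_mult R \<one>\<^bsub>G\<^esub> ?h X \<cdot> act_mult R g ?h ?Y" .
      note eq = Cmp_replace[OF eq]
      show ?thesis by (subst eq) (simp_all add: Cmp_assoc)
    qed
    also have "\<dots> = act_mult R \<one>\<^bsub>G\<^esub> ?h X \<cdot> ((?e \<triangleleft> ?\<sigma>) \<cdot> (act_mult R g ?h (X \<odot> ?t) \<cdot>
          ((?s \<triangleleft> assoc B ?t X ?t) \<cdot> assoc B ?s ?Y ?t)))"
      by (subst act_mult_nat[where P = "X \<odot> ?t"]) (simp_all add: Cmp_assoc)
    also have "\<dots> = absorb ?h \<one>\<^bsub>G\<^esub> \<cdot> (act_mult R g ?h X \<triangleright> ?t)"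
      by (simp add: act_mult_rw absorb_def Cmp_assoc)
    also have "absorb ?h \<one>\<^bsub>G\<^esub> = ?\<sigma> \<cdot> (cinv B (?u X) \<triangleright> ?t)"
      by (simp add: absorb_unit[symmetric] Cmp_assoc cinv_rw[symmetric])
    finally show ?thesis by (simp add: rw_Cmp Cmp_assoc)
  qed
  have hex: "theta S (?Y \<odot> ?t) ?s \<cdot>\<^bsub>T\<^esub> shA S (cinv B (assoc B ?Y ?t ?s) \<cdot>
        ((?Y \<triangleleft> ?coev) \<cdot> cinv B (runit B ?Y)))
    = shA S (assoc B ?s ?Y ?t) \<cdot>\<^bsub>T\<^esub> (theta S ?t (?s \<odot> ?Y) \<cdot>\<^bsub>T\<^esub> shA S (assoc B ?t ?s ?Y \<cdot> ((?coev \<triangleright> ?Y) \<cdot> cinv B (lunit B ?Y))))"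
  proof -
    have "shA S (lunit B ?Y) \<cdot>\<^bsub>T\<^esub> theta S ?Y (U R) = shA S (runit B ?Y)"
      by (rule theta_runit) (simp add: cell1_def)
    then have "theta S ?Y (U R) = shA S (cinv B (lunit B ?Y)) \<cdot>\<^bsub>T\<^esub> shA S (runit B ?Y)"
      by (simp add: cinv_shA[symmetric] flip: \<open>_ = shA S (runit B ?Y)\<close>)
    then have unit: "theta S ?Y (U R) \<cdot>\<^bsub>T\<^esub> shA S (cinv B (runit B ?Y)) = shA S (cinv B (lunit B ?Y))"
      by (simp add: T.Cmp_assoc cinv_shA[symmetric])
    have "theta S (?Y \<odot> ?t) ?s \<cdot>\<^bsub>T\<^esub> shA S (cinv B (assoc B ?Y ?t ?s) \<cdot>
          ((?Y \<triangleleft> ?coev) \<cdot> cinv B (runit B ?Y)))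
      = shA S (assoc B ?s ?Y ?t) \<cdot>\<^bsub>T\<^esub> (theta S ?t (?s \<odot> ?Y) \<cdot>\<^bsub>T\<^esub> (shA S (assoc B ?t ?s ?Y) \<cdot>\<^bsub>T\<^esub>
         ((theta S ?Y (?t \<odot> ?s) \<cdot>\<^bsub>T\<^esub> shA S (?Y \<triangleleft> ?coev)) \<cdot>\<^bsub>T\<^esub> shA S (cinv B (runit B ?Y)))))"
      by (simp add: theta_hexagon'[of ?Y ?t ?s] shA_Cmp[of _ "cinv B (assoc B ?Y ?t ?s)"] shA_Cmp[of "cinv B (runit B ?Y)"] T.Cmp_assoc cinv_shA[of "assoc B ?Y ?t ?s", symmetric])
    also have "theta S ?Y (?t \<odot> ?s) \<cdot>\<^bsub>T\<^esub> shA S (?Y \<triangleleft> ?coev) = shA S (?coev \<triangleright> ?Y) \<cdot>\<^bsub>T\<^esub> theta S ?Y (U R)"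
      by (rule theta_nat) simp_all
    finally show ?thesis by (simp add: T.Cmp_assoc unit) (simp add: shA_Cmp T.Cmp_assoc)
  qed
  define m m' p q r v w k where defs: "m = ?m" "m' = ?m'" "p = ?s \<triangleleft> (?t \<triangleleft> ?\<sigma>)" "q = ?s \<triangleleft> assoc B ?t X ?t"
    "r = assoc B ?s ?Y ?t" "v = cinv B (assoc B ?Y ?t ?s) \<cdot> ((?Y \<triangleleft> ?coev) \<cdot> cinv B (runit B ?Y))"
    "w = assoc B ?t ?s ?Y \<cdot> ((?coev \<triangleright> ?Y) \<cdot> cinv B (lunit B ?Y))" "k = ?\<kappa>"
  have [simp]: "m \<in> Ar B" "Dom B m = ((?s \<odot> ?t) \<odot> ?t) \<odot> X" "Cod B m = ?Y"
    "m' \<in> Ar B" "Dom B m' = ?s \<odot> (?t \<odot> (?t \<odot> X))" "Cod B m' = ((?s \<odot> ?t) \<odot> ?t) \<odot> X"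
    "p \<in> Ar B" "Dom B p = ?s \<odot> (?t \<odot> (X \<odot> ?t))" "Cod B p = ?s \<odot> (?t \<odot> (?t \<odot> X))"
    "q \<in> Ar B" "Dom B q = ?s \<odot> (?Y \<odot> ?t)" "Cod B q = ?s \<odot> (?t \<odot> (X \<odot> ?t))"
    "r \<in> Ar B" "Dom B r = (?s \<odot> ?Y) \<odot> ?t" "Cod B r = ?s \<odot> (?Y \<odot> ?t)"
    "w \<in> Ar B" "Dom B w = ?Y" "Cod B w = ?t \<odot> (?s \<odot> ?Y)"
    "k \<in> Ar B" "Dom B k = ?s \<odot> ?Y" "Cod B k = X"
    by (simp_all add: defs)
  have "conj_transport B G W T S g g Z = shA S m \<cdot>\<^bsub>T\<^esub> (shA S m' \<cdot>\<^bsub>T\<^esub> (shA S p \<cdot>\<^bsub>T\<^esub> (shA S q \<cdot>\<^bsub>T\<^esub>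
     (theta S (?Y \<odot> ?t) ?s \<cdot>\<^bsub>T\<^esub> shA S v))))"
    by (simp add: conj_transport_def Let_def X transport_def defs)
  also have "\<dots> = shA S (m \<cdot> (m' \<cdot> (p \<cdot> (q \<cdot> r)))) \<cdot>\<^bsub>T\<^esub> (theta S ?t (?s \<odot> ?Y) \<cdot>\<^bsub>T\<^esub> shA S w)"
    by (simp add: hex[folded defs] shA_Cmp T.Cmp_assoc)
  also have "m \<cdot> (m' \<cdot> (p \<cdot> (q \<cdot> r))) = ?\<sigma> \<cdot> (k \<triangleright> ?t)"
    using slip by (simp only: defs)
  also have "shA S (?\<sigma> \<cdot> (k \<triangleright> ?t)) \<cdot>\<^bsub>T\<^esub> (theta S ?t (?s \<odot> ?Y) \<cdot>\<^bsub>T\<^esub> shA S w)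
    = shA S ?\<sigma> \<cdot>\<^bsub>T\<^esub> ((shA S (k \<triangleright> ?t) \<cdot>\<^bsub>T\<^esub> theta S ?t (?s \<odot> ?Y)) \<cdot>\<^bsub>T\<^esub> shA S w)"
    by (simp add: shA_Cmp T.Cmp_assoc)
  also have "shA S (k \<triangleright> ?t) \<cdot>\<^bsub>T\<^esub> theta S ?t (?s \<odot> ?Y) = theta S ?t X \<cdot>\<^bsub>T\<^esub> shA S (?t \<triangleleft> k)"
    by (rule theta_nat[symmetric]) simp_all
  also have "shA S ?\<sigma> \<cdot>\<^bsub>T\<^esub> ((theta S ?t X \<cdot>\<^bsub>T\<^esub> shA S (?t \<triangleleft> k)) \<cdot>\<^bsub>T\<^esub> shA S w)
    = shA S ?\<sigma> \<cdot>\<^bsub>T\<^esub> (theta S ?t X \<cdot>\<^bsub>T\<^esub> shA S ((?t \<triangleleft> k) \<cdot> w))"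
    by (simp add: shA_Cmp T.Cmp_assoc)
  also have "(?t \<triangleleft> k) \<cdot> w = Idn B ?Y"
    using zigzag by (simp only: defs)
  also have "shA S ?\<sigma> \<cdot>\<^bsub>T\<^esub> (theta S ?t X \<cdot>\<^bsub>T\<^esub> shA S (Idn B ?Y)) = rotation X \<tau> ?h"
    by (simp add: rotation_def)
  finally show ?thesis .
qed

end

section \<open>The twofold twisted cyclicity\<close>

theorem proposition4p8:
  fixes B :: "('o, 'a, 'c) bicat"
    and T :: "('x, 't) cat"
    and S :: "('a, 'c, 'x, 't) shadow_data"
    and G :: "('g, 'z) monoid_scheme"
    and W :: "('o, 'g, 'a, 'c) twisting"
    and g :: 'g
    and R Q :: 'o
    and M N :: "'a \<times> ('g \<Rightarrow> 'c)"
  assumes "shadowed_bicategory B T S"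
    and "twisting_data B G W"
    and "g \<in> carrier G"
    and "M \<in> cell1 (twists B G W) R Q"
    and "N \<in> cell1 (twists B G W) Q R"
  shows "let MN = M \<odot>\<^bsub>twists B G W\<^esub> N;
             \<Psi> = tw_theta B G W T S g N M \<cdot>\<^bsub>T\<^esub> tw_theta B G W T S g M N
         in \<Psi> \<in> isos T (tw_shadow B G W S g MN) (tw_shadow B G W S g MN)
          \<and> \<Psi> = conj_transport B G W T S g g MN
          \<and> (\<forall>n. n > 0 \<and> group.ord G g = n
                \<longrightarrow> cpow T \<Psi> n = Idn T (tw_shadow B G W S g MN))"
proof -
  interpret sh: shadowed_bicategory B T S by fact
  interpret tw: twisting_data B G W by fact
  interpret twisted_shadow B T S G W ..
  let ?MN = "tw_comp1 B G W M N" let ?b = "inv\<^bsub>G\<^esub> g"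
  let ?\<Psi> = "tw_theta B G W T S g N M \<cdot>\<^bsub>T\<^esub> tw_theta B G W T S g M N"
  note hM = tw.twist_half_braiding[OF assms(4)] and hN = tw.twist_half_braiding[OF assms(5)]
  have MN: "M \<odot>\<^bsub>twists B G W\<^esub> N = ?MN" by (simp add: twists_def)
  have fst: "fst ?MN = fst M \<odot>\<^bsub>B\<^esub> fst N" by (simp add: tw_comp1_def Let_def)
  have "snd ?MN b = tw.comp_braiding R Q R (fst M) (snd M) (fst N) (snd N) b" if "b \<in> carrier G" for b
    using tw.half_braiding_simps[OF hM] tw.half_braiding_simps[OF hN] that by (intro snd_tw_comp1)
  then have hb: "tw.half_braiding R R (fst ?MN) (snd ?MN)"
    using tw.half_braiding_comp[OF hM hN] unfolding fst by (subst tw.half_braiding_cong) simp_all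
  interpret MN: endo_half_braiding B T S G W R "fst ?MN" "snd ?MN"
    by unfold_locales (rule hb)
  note b = tw.G.inv_closed[OF assms(3)]
  have \<Psi>: "?\<Psi> = rotation (fst ?MN) (snd ?MN) ?b"
    by (rule twofold_tw_theta[OF hM hN assms(3)])
  have "tw_shadow B G W S g ?MN = shO S (Th W R ?b \<odot>\<^bsub>B\<^esub> fst ?MN)"
    using tw.half_braiding_simps[OF hb] by (simp add: tw_shadow_def ltwist_def)
  moreover have "?\<Psi> \<in> isos T (shO S (Th W R ?b \<odot>\<^bsub>B\<^esub> fst ?MN)) (shO S (Th W R ?b \<odot>\<^bsub>B\<^esub> fst ?MN))"
    unfolding \<Psi> sh.T.isos_iff using MN.rotation_simps[OF b] by simp
  moreover have "?\<Psi> = conj_transport B G W T S g g ?MN"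
    unfolding \<Psi> by (rule MN.conj_transport_eq_rotation[OF assms(3) refl refl, symmetric])
  moreover have "cpow T ?\<Psi> n = Idn T (shO S (Th W R ?b \<odot>\<^bsub>B\<^esub> fst ?MN))"
    if "n > 0" "group.ord G g = n" for n
  proof -
    have "g [^]\<^bsub>G\<^esub> n = \<one>\<^bsub>G\<^esub>" using tw.G.pow_ord_eq_1[OF assms(3)] that by simp
    then have "?b [^]\<^bsub>G\<^esub> n = \<one>\<^bsub>G\<^esub>" using tw.G.nat_pow_inv[OF assms(3), of n] by simp
    then show ?thesis unfolding \<Psi> by (rule MN.rotation_power_one[OF b])
  qed
  ultimately show ?thesis by (simp add: MN Let_def)
qed

end
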